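(* There is a constant $c>0$ and an algorithm (Algorithm FIND-DECOMPOSITION-IN-BIPARTITE) which, given any bipartite graph $G=(A,B,E)$ with $|A|=a$, $|B|=b$ (and $a+b\ge 2$), finds a decomposition of $G$ into balanced complete bipartite graphs having complexity at most $c\,\frac{ab}{\ln(a+b)}$, i.e., $O\!\left(\frac{ab}{\ln(a+b)}\right)$, with running time polynomial in $a+b$.
   Context: A bipartite graph $G=(A,B,E)$ has disjoint vertex classes $A,B$ and every edge joins $A$ to $B$. A decomposition of $G$ into complete bipartite graphs is a family of complete bipartite subgraphs $G_i=(A_i,B_i,E_i)$, $i=1,\dots,t$, of $G$ (where $E_i$ is the set of all pairs between $A_i$ and $B_i$, all of which are edges of $G$) such that $E_1,\dots,E_t$ partition $E$. Its complexity is $\sum_{i=1}^t(|A_i|+|B_i|)$; it is into balanced complete bipartite graphs if $|A_i|=|B_i|$ for all $i$. The algorithm of the paper repeatedly (while more than $ab/\ln(a+b)$ edges remain) finds a balanced complete bipartite subgraph by taking a set $R$ of highest-degree vertices in the smaller class and checking common neighbourhoods of all $q$-element subsets of $R$, deletes its edges, and finally takes each remaining edge as a separate $K_{1,1}$.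
   Formalization: The bound c·ab/ln(a+b) is claimed only when ln(a+b) ≤ K·min(a,b), with c depending on K, since it fails for stars K_{1,n} (complexity 2n); the polynomial-time algorithm is shown to exist, by a method other than FIND-DECOMPOSITION-IN-BIPARTITE. *)

theory Defs
  imports Complex_Main "HOL-Library.Disjoint_Sets" "HOL-Computational_Algebra.Polynomial"
begin

section \<open>Bipartite graphs and decompositions\<close>

text \<open>An edge joining \<open>u \<in> A\<close> to \<open>v \<in> B\<close> is the pair \<open>(u, v)\<close>.\<close>

definition bipartite_graph :: "'v set \<Rightarrow> 'v set \<Rightarrow> ('v \<times> 'v) set \<Rightarrow> bool" where
  "bipartite_graph A B E \<longleftrightarrow> finite A \<and> finite B \<and> A \<inter> B = {} \<and> E \<subseteq> A \<times> B"

text \<open>The complete bipartite subgraph \<open>(X, Y, X \<times> Y)\<close> is represented by the pair \<open>(X, Y)\<close>.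
  As usual for partitions, the parts \<open>X \<times> Y\<close> are nonempty.\<close>

definition decomposition ::
    "'v set \<Rightarrow> 'v set \<Rightarrow> ('v \<times> 'v) set \<Rightarrow> ('v set \<times> 'v set) list \<Rightarrow> bool" where
  "decomposition A B E D \<longleftrightarrow>
     (\<forall>(X, Y) \<in> set D. X \<subseteq> A \<and> Y \<subseteq> B \<and> X \<times> Y \<subseteq> E \<and> X \<times> Y \<noteq> {}) \<and>
     disjoint_family_on (\<lambda>i. fst (D ! i) \<times> snd (D ! i)) {..<length D} \<and>
     (\<Union>(X, Y) \<in> set D. X \<times> Y) = E"

definition balanced :: "('v set \<times> 'v set) list \<Rightarrow> bool" where
  "balanced D \<longleftrightarrow> (\<forall>(X, Y) \<in> set D. card X = card Y)"

definition complexity :: "('v set \<times> 'v set) list \<Rightarrow> nat" where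
  "complexity D = (\<Sum>(X, Y) \<leftarrow> D. card X + card Y)"

text \<open>Without a restriction on the sizes, a bound \<open>c * a * b / ln (a + b)\<close> on the complexity of
  balanced decompositions is impossible: the only balanced decomposition of a star with \<open>n\<close> edges
  is into single edges and has complexity \<open>2 * n\<close>.  For complete bipartite graphs such a bound
  forces \<open>ln (a + b) \<le> c / 2 * min a b\<close>.\<close>

lemma balanced_decomposition_complete_lower_bound:
  assumes G: "bipartite_graph A B (A \<times> B)" and D: "decomposition A B (A \<times> B) D" and "balanced D"
  shows "2 * (card A * card B) \<le> min (card A) (card B) * complexity D"
proof -
  let ?e = "\<lambda>i. fst (D ! i) \<times> snd (D ! i)"
  have fin: "finite A" "finite B" using G by (auto simp: bipartite_graph_def)
  have "\<forall>p \<in> set D. fst p \<subseteq> A \<and> snd p \<subseteq> B"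
    using D unfolding decomposition_def case_prod_unfold by blast
  hence sub: "fst (D ! i) \<subseteq> A \<and> snd (D ! i) \<subseteq> B" if "i < length D" for i
    using nth_mem[OF that] by blast
  have bal: "card (fst (D ! i)) = card (snd (D ! i))" if "i < length D" for i
    using \<open>balanced D\<close> nth_mem[OF that] unfolding balanced_def case_prod_unfold by blast
  have disj: "disjoint_family_on ?e {..<length D}"
    using D unfolding decomposition_def by (elim conjE)
  have "A \<times> B = (\<Union>p \<in> set D. fst p \<times> snd p)"
    using D unfolding decomposition_def case_prod_unfold by (elim conjE) (rule sym)
  also have "set D = (!) D ` {..<length D}"
    by (auto simp: set_conv_nth)
  also have "(\<Union>p \<in> (!) D ` {..<length D}. fst p \<times> snd p) = (\<Union>i \<in> {..<length D}. ?e i)"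
    by (simp only: image_image)
  finally have "card A * card B = card (\<Union>i \<in> {..<length D}. ?e i)"
    by (simp only: card_cartesian_product[symmetric])
  also have "\<dots> = (\<Sum>i<length D. card (?e i))"
  proof (rule card_UN_disjoint)
    show "\<forall>i\<in>{..<length D}. finite (?e i)"
      using sub fin by (auto intro!: finite_cartesian_product intro: finite_subset)
    show "\<forall>i\<in>{..<length D}. \<forall>j\<in>{..<length D}. i \<noteq> j \<longrightarrow> ?e i \<inter> ?e j = {}"
      using disj unfolding disjoint_family_on_def .
  qed simp
  finally have "2 * (card A * card B) = (\<Sum>i<length D. 2 * card (?e i))"
    by (simp add: sum_distrib_left)
  also have "\<dots> \<le> (\<Sum>i<length D. min (card A) (card B) * (card (fst (D ! i)) + card (snd (D ! i))))"
  proof (rule sum_mono)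
    fix i assume "i \<in> {..<length D}"
    hence i: "i < length D" by simp
    have "card (fst (D ! i)) \<le> card A" "card (snd (D ! i)) \<le> card B"
      using sub[OF i] fin by (auto intro: card_mono)
    hence "card (snd (D ! i)) \<le> min (card A) (card B)" using bal[OF i] by simp
    hence "card (snd (D ! i)) * (2 * card (snd (D ! i)))
        \<le> min (card A) (card B) * (2 * card (snd (D ! i)))"
      by (rule mult_right_mono) simp
    thus "2 * card (?e i) \<le> min (card A) (card B) * (card (fst (D ! i)) + card (snd (D ! i)))"
      unfolding card_cartesian_product bal[OF i] by (simp add: mult_2[symmetric] mult.left_commute)
  qed
  also have "\<dots> = min (card A) (card B) * complexity D"
    unfolding complexity_def
    by (simp add: sum_list_sum_nth case_prod_unfold atLeast0LessThan flip: sum_distrib_left)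
  finally show ?thesis .
qed

lemma balanced_bound_imp_ln_le:
  fixes A B :: "'v set"
  assumes "bipartite_graph A B (A \<times> B)" "decomposition A B (A \<times> B) D" "balanced D"
    and "A \<noteq> {}" "B \<noteq> {}"
    and bound: "real (complexity D) \<le> c * (real (card A * card B) / ln (real (card A + card B)))"
  shows "ln (real (card A + card B)) \<le> c / 2 * real (min (card A) (card B))"
proof -
  let ?L = "ln (real (card A + card B))" and ?m = "real (min (card A) (card B))"
    and ?P = "real (card A * card B)"
  have pos: "card A > 0" "card B > 0"
    using assms by (auto simp: bipartite_graph_def card_gt_0_iff)
  hence L: "?L > 0" and P: "?P > 0" by auto
  have "2 * ?P \<le> ?m * real (complexity D)"
    using of_nat_mono[OF balanced_decomposition_complete_lower_bound[OF assms(1-3)], where ?'a = real]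
    by simp
  also have "\<dots> \<le> ?m * (c * (?P / ?L))"
    using bound by (intro mult_left_mono) auto
  finally have "2 * ?P * ?L \<le> ?m * c * ?P"
    using L by (simp add: field_simps del: of_nat_mult of_nat_add of_nat_min)
  hence "?P * (2 * ?L) \<le> ?P * (c * ?m)" by (simp only: mult_ac)
  hence "2 * ?L \<le> c * ?m" using P by (metis mult_le_cancel_left_pos)
  thus ?thesis by simp
qed

lemma no_bound_for_all_bipartite_graphs:
  "\<nexists>c. \<forall>A B E. bipartite_graph (A :: nat set) B E \<and> card A + card B \<ge> 2 \<longrightarrow>
     (\<exists>D. decomposition A B E D \<and> balanced D \<and>
          real (complexity D) \<le> c * (real (card A * card B) / ln (real (card A + card B))))"
proof
  assume "\<exists>c. \<forall>A B E. bipartite_graph (A :: nat set) B E \<and> card A + card B \<ge> 2 \<longrightarrow>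
     (\<exists>D. decomposition A B E D \<and> balanced D \<and>
          real (complexity D) \<le> c * (real (card A * card B) / ln (real (card A + card B))))"
  then obtain c where c: "\<And>A B E. bipartite_graph (A :: nat set) B E \<Longrightarrow> card A + card B \<ge> 2 \<Longrightarrow>
     (\<exists>D. decomposition A B E D \<and> balanced D \<and>
          real (complexity D) \<le> c * (real (card A * card B) / ln (real (card A + card B))))"
    by blast
  obtain n :: nat where n: "real n > exp (c / 2)" using reals_Archimedean2 by blast
  hence "real n > 0" using exp_gt_zero[of "c / 2"] by linarith
  hence n0: "n > 0" by simp
  have G: "bipartite_graph {0} {1..n} ({0} \<times> {1..n})" by (auto simp: bipartite_graph_def)
  have "card {0::nat} + card {1..n} \<ge> 2" using n0 by simp
  from c[OF G this] obtain D where "decomposition {0} {1..n} ({0} \<times> {1..n}) D" "balanced D"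
    "real (complexity D) \<le> c * (real (card {0::nat} * card {1..n}) / ln (real (card {0::nat} + card {1..n})))"
    by blast
  from balanced_bound_imp_ln_le[OF G this(1,2) _ _ this(3)] n0
  have "ln (1 + real n) \<le> c / 2" by simp
  moreover have "c / 2 < ln (1 + real n)"
  proof -
    have "ln (exp (c / 2)) < ln (1 + real n)" using n by (subst ln_less_cancel_iff) (auto intro: add_pos_nonneg)
    thus ?thesis by simp
  qed
  ultimately show False by simp
qed

section \<open>Machine model\<close>

text \<open>Structured programs for a random access machine with unit cost per elementary operation.
  The memory consists of arrays, numbered by constants of the program (so that a program uses
  finitely many of them), whose cells hold natural numbers.  Addition and truncated subtraction
  are the only arithmetic operations: one operation at most doubles the largest value, so the
  numbers occurring in \<open>t\<close> steps have \<open>O(t)\<close> more bits than the input and the model is polynomially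
  equivalent to Turing machines.\<close>

type_synonym memory = "nat \<Rightarrow> nat \<Rightarrow> nat"

datatype aexp = Num nat | Get nat aexp | Add aexp aexp | Sub aexp aexp

datatype bexp = Less aexp aexp | Neg bexp | Conj bexp bexp

datatype prog =
    Skip
  | Put nat aexp aexp
  | Seq prog prog
  | Cond bexp prog prog
  | While bexp prog

fun aval :: "aexp \<Rightarrow> memory \<Rightarrow> nat" where
  "aval (Num n) s = n"
| "aval (Get k e) s = s k (aval e s)"
| "aval (Add e f) s = aval e s + aval f s"
| "aval (Sub e f) s = aval e s - aval f s"

fun acost :: "aexp \<Rightarrow> nat" where
  "acost (Num n) = 1"
| "acost (Get k e) = acost e + 1"
| "acost (Add e f) = acost e + acost f + 1"
| "acost (Sub e f) = acost e + acost f + 1"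

fun bval :: "bexp \<Rightarrow> memory \<Rightarrow> bool" where
  "bval (Less e f) s \<longleftrightarrow> aval e s < aval f s"
| "bval (Neg b) s \<longleftrightarrow> \<not> bval b s"
| "bval (Conj b b') s \<longleftrightarrow> bval b s \<and> bval b' s"

fun bcost :: "bexp \<Rightarrow> nat" where
  "bcost (Less e f) = acost e + acost f + 1"
| "bcost (Neg b) = bcost b + 1"
| "bcost (Conj b b') = bcost b + bcost b' + 1"

text \<open>\<open>exec P s t s'\<close>: started in memory \<open>s\<close>, the program \<open>P\<close> halts after exactly \<open>t\<close> steps in
  memory \<open>s'\<close>.\<close>

inductive exec :: "prog \<Rightarrow> memory \<Rightarrow> nat \<Rightarrow> memory \<Rightarrow> bool" where
  Skip: "exec Skip s 1 s"
| Put: "exec (Put k e f) s (acost e + acost f + 1) (s(k := (s k)(aval e s := aval f s)))"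
| Seq: "exec P s t s' \<Longrightarrow> exec Q s' t' s'' \<Longrightarrow> exec (Seq P Q) s (t + t') s''"
| CondTrue: "bval b s \<Longrightarrow> exec P s t s' \<Longrightarrow> exec (Cond b P Q) s (bcost b + t + 1) s'"
| CondFalse: "\<not> bval b s \<Longrightarrow> exec Q s t s' \<Longrightarrow> exec (Cond b P Q) s (bcost b + t + 1) s'"
| WhileFalse: "\<not> bval b s \<Longrightarrow> exec (While b P) s (bcost b + 1) s"
| WhileTrue: "bval b s \<Longrightarrow> exec P s t s' \<Longrightarrow> exec (While b P) s' t' s'' \<Longrightarrow>
    exec (While b P) s (bcost b + t + t' + 1) s''"

inductive_cases exec_elims:
  "exec Skip s t s'"
  "exec (Put k e f) s t s'"
  "exec (Seq P Q) s t s'"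
  "exec (Cond b P Q) s t s'"

inductive_cases exec_While: "exec (While b P) s t s'"

lemma exec_deterministic:
  "exec P s t s' \<Longrightarrow> exec P s u s'' \<Longrightarrow> t = u \<and> s' = s''"
proof (induction arbitrary: u s'' rule: exec.induct)
  case (Skip s)
  from Skip.prems show ?case by (rule exec_elims(1)) simp
next
  case (Put k e f s)
  from Put.prems show ?case by (rule exec_elims(2)) simp
next
  case (Seq P s t s' Q t' r)
  from Seq.prems show ?case
  proof (rule exec_elims(3))
    fix v q v'
    assume u: "u = v + v'" and q: "exec P s v q" and r: "exec Q q v' s''"
    have "t = v \<and> s' = q" using Seq.IH(1)[OF q] .
    moreover from this have "t' = v' \<and> r = s''" using Seq.IH(2) r by simp
    ultimately show ?thesis using u by simp
  qed
next
  case (CondTrue b s P t s' Q)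
  from CondTrue.prems show ?case
  proof (rule exec_elims(4))
    fix v assume "u = Suc (bcost b + v)" "exec P s v s''"
    thus ?thesis using CondTrue.IH[of v s''] by simp
  qed (use CondTrue.hyps in simp)
next
  case (CondFalse b s Q t s' P)
  from CondFalse.prems show ?case
  proof (rule exec_elims(4))
    fix v assume "u = Suc (bcost b + v)" "exec Q s v s''"
    thus ?thesis using CondFalse.IH[of v s''] by simp
  qed (use CondFalse.hyps in simp)
next
  case (WhileFalse b s P)
  from WhileFalse.prems show ?case by (rule exec_While) (use WhileFalse.hyps in simp_all)
next
  case (WhileTrue b s P t s' t' r)
  from WhileTrue.prems show ?case
  proof (rule exec_While)
    fix v q v'
    assume u: "u = Suc (bcost b + v + v')" and q: "exec P s v q" and r: "exec (While b P) q v' s''"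
    have "t = v \<and> s' = q" using WhileTrue.IH(1)[OF q] .
    moreover from this have "t' = v' \<and> r = s''" using WhileTrue.IH(2) r by simp
    ultimately show ?thesis using u by simp
  qed (use WhileTrue.hyps in simp)
qed

section \<open>Input and output\<close>

text \<open>The program sees a graph through an enumeration \<open>xs\<close> of \<open>A\<close> and \<open>ys\<close> of \<open>B\<close>: array 0 holds
  the numbers of vertices, array 1 the adjacency matrix row by row, all other cells are 0.\<close>

definition input_memory :: "'v list \<Rightarrow> 'v list \<Rightarrow> ('v \<times> 'v) set \<Rightarrow> memory" where
  "input_memory xs ys E = (\<lambda>_ _. 0)
     (0 := (\<lambda>_. 0)(0 := length xs, 1 := length ys),
      1 := (\<lambda>n. if n < length xs * length ys \<and> (xs ! (n div length ys), ys ! (n mod length ys)) \<in> E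
                then 1 else 0))"

text \<open>The output is read from array 2: the number of subgraphs, followed, for each subgraph
  \<open>(X, Y)\<close>, by the two repetition-free lists of the indices in \<open>xs\<close> and in \<open>ys\<close> of the elements
  of \<open>X\<close> and \<open>Y\<close>, each list preceded by its length.\<close>

definition output_code :: "(nat list \<times> nat list) list \<Rightarrow> nat list" where
  "output_code I =
     length I # concat (map (\<lambda>(us, vs). length us # us @ length vs # vs) I)"

definition outputs ::
    "memory \<Rightarrow> 'v list \<Rightarrow> 'v list \<Rightarrow> ('v set \<times> 'v set) list \<Rightarrow> bool" where
  "outputs s xs ys D \<longleftrightarrow>
     (\<exists>I. (\<forall>n < length (output_code I). s 2 n = output_code I ! n) \<and>
          (\<forall>(us, vs) \<in> set I. distinct us \<and> set us \<subseteq> {..<length xs} \<and>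
                              distinct vs \<and> set vs \<subseteq> {..<length ys}) \<and>
          D = map (\<lambda>(us, vs). ((!) xs ` set us, (!) ys ` set vs)) I)"

end

theory Submission
  imports Defs
begin

text \<open>Let \<open>m \<le> n\<close> be the sizes of the two classes, arranged as rows and columns of the adjacency
  matrix, and let \<open>4^(k-1) \<le> n < 4^k\<close>.  Cut the rows into blocks of \<open>k\<close>.  Within a block, each
  column has a pattern \<open>S\<close>, its set of neighbours among the rows of the block; any \<open>|S|\<close> columns
  with the same pattern \<open>S\<close> form a balanced complete bipartite graph with \<open>S\<close>, and such graphs are split
  off greedily.  Each column is used at most once per block, so a block contributes at most \<open>2 n\<close> to the
  complexity.  Afterwards each of the at most \<open>2^k\<close> patterns \<open>S\<close> is left with fewer than \<open>|S|\<close> columns,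
  hence at most \<open>2^k k (k - 1) \<le> 8 n\<close> edges of the block remain, which are taken as single edges.
  In total the complexity is at most \<open>18 n\<close> for each of at most \<open>m / k + 1\<close> blocks, where
  \<open>k\<close> is of order \<open>ln (m + n)\<close>.  This replaces the density argument of the paper.\<close>

section \<open>Timed total correctness\<close>

text \<open>The base 4 in the choice of \<open>k\<close> provides the slack: \<open>2^(k-1)\<close>
  is at most the square root of \<open>n\<close>, so one factor \<open>2^(k-1)\<close> is left over
  to absorb \<open>k (k - 1)\<close>. With \<open>2^k\<close> of order \<open>n\<close> the count of
  leftover edges would carry the extra factor \<open>k (k - 1)\<close>. The obstacle is the summand
  1 in \<open>m / k + 1\<close>, the cost of a last incomplete block. It is absorbed by the
  hypothesis that \<open>ln (m + n)\<close> is at most \<open>K * m\<close>, the only place where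
  the proportions of the graph matter. A single pass over the columns of a block suffices: a column
  that is used becomes empty, so the class of a nonempty pattern can only shrink, and a pattern once
  found to have too few columns stays so. The leftover edges need no routine of their own. With
  blocks of one row, a nonempty pattern is that row alone and the pivot is enough to form a graph,
  so a second round removes every edge.\<close>

definition runs :: "prog \<Rightarrow> memory \<Rightarrow> nat \<Rightarrow> (memory \<Rightarrow> bool) \<Rightarrow> bool" where
  "runs P s T Q \<longleftrightarrow> (\<exists>t s'. exec P s t s' \<and> t \<le> T \<and> Q s')"

lemma runs_mono:
  "runs P s T Q \<Longrightarrow> T \<le> T' \<Longrightarrow> (\<And>s'. Q s' \<Longrightarrow> Q' s') \<Longrightarrow> runs P s T' Q'"
  unfolding runs_def by (meson le_trans)

lemma runs_Skip: "1 \<le> T \<Longrightarrow> Q s \<Longrightarrow> runs Skip s T Q"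
  unfolding runs_def by (blast intro: exec.Skip)

lemma runs_Put:
  "acost e + acost f + 1 \<le> T \<Longrightarrow> Q (s(k := (s k)(aval e s := aval f s))) \<Longrightarrow> runs (Put k e f) s T Q"
  unfolding runs_def by (blast intro: exec.Put)

lemma runs_Seq:
  assumes "runs P s T Q" "\<And>s'. Q s' \<Longrightarrow> runs P' s' T' Q'" "T + T' \<le> T''"
  shows "runs (Seq P P') s T'' Q'"
proof -
  obtain t s' where 1: "exec P s t s'" "t \<le> T" "Q s'" using assms(1) by (auto simp: runs_def)
  obtain t' s'' where 2: "exec P' s' t' s''" "t' \<le> T'" "Q' s''"
    using assms(2)[OF 1(3)] by (auto simp: runs_def)
  show ?thesis unfolding runs_def
    using exec.Seq[OF 1(1) 2(1)] 1 2 assms(3) by (intro exI[of _ "t + t'"] exI[of _ s'']) auto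
qed

lemma runs_Seq_Put:
  assumes "acost e + acost f + 1 + T \<le> T'" "runs P (s(k := (s k)(aval e s := aval f s))) T Q"
  shows "runs (Seq (Put k e f) P) s T' Q"
  by (rule runs_Seq[OF runs_Put[OF order_refl, where Q = "\<lambda>s'. s' = s(k := (s k)(aval e s := aval f s))"]])
     (use assms in auto)

lemma runs_Cond:
  assumes "bval b s \<Longrightarrow> runs P s T Q" "\<not> bval b s \<Longrightarrow> runs P' s T Q" "bcost b + T + 1 \<le> T'"
  shows "runs (Cond b P P') s T' Q"
proof (cases "bval b s")
  case True
  then obtain t s' where "exec P s t s'" "t \<le> T" "Q s'" using assms(1) by (auto simp: runs_def)
  then show ?thesis unfolding runs_def using exec.CondTrue[OF True, of P t s' P'] assms(3)
    by (intro exI[of _ "bcost b + t + 1"] exI[of _ s']) auto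
next
  case False
  then obtain t s' where "exec P' s t s'" "t \<le> T" "Q s'" using assms(2) by (auto simp: runs_def)
  then show ?thesis unfolding runs_def using exec.CondFalse[OF False, of P' t s' P] assms(3)
    by (intro exI[of _ "bcost b + t + 1"] exI[of _ s']) auto
qed

text \<open>The number \<open>c\<close> of iterations is known in advance, so it serves both for
  termination and as a factor of the time bound; the induction is on the remaining iterations
  \<open>c - i\<close>.\<close>

lemma runs_While:
  assumes "I (0::nat) s"
    and step: "\<And>i s'. i < c \<Longrightarrow> I i s' \<Longrightarrow> bval b s' \<and> runs P s' T (I (Suc i))"
    and exit: "\<And>s'. I c s' \<Longrightarrow> \<not> bval b s'"
    and "c * (bcost b + T + 1) + bcost b + 1 \<le> T'"
  shows "runs (While b P) s T' (I c)"
proof -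
  have "runs (While b P) s ((c - i) * (bcost b + T + 1) + bcost b + 1) (I c)" if "i \<le> c" "I i s" for i
    using that
  proof (induction "c - i" arbitrary: i s)
    case 0
    then have "i = c" by simp
    then show ?case unfolding runs_def
      using 0 exit[of s] exec.WhileFalse[of b s P] by (intro exI[of _ "bcost b + 1"] exI[of _ s]) auto
  next
    case (Suc d)
    then have i: "i < c" by simp
    obtain t s' where 1: "exec P s t s'" "t \<le> T" "I (Suc i) s'" and b: "bval b s"
      using step[OF i Suc.prems(2)] by (auto simp: runs_def)
    have d: "d = c - Suc i" using Suc.hyps(2) by simp
    then obtain t' s'' where 2: "exec (While b P) s' t' s''" "t' \<le> d * (bcost b + T + 1) + bcost b + 1" "I c s''"
      using Suc.hyps(1)[OF d, of s'] i 1 by (auto simp: runs_def)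
    show ?case unfolding runs_def
      using exec.WhileTrue[OF b 1(1) 2(1)] 1 2
      by (intro exI[of _ "bcost b + t + t' + 1"] exI[of _ s'']) (auto simp flip: Suc.hyps(2))
  qed
  from this[of 0] assms show ?thesis by (auto intro: runs_mono)
qed

section \<open>Counting loops\<close>

abbreviation Var :: "nat \<Rightarrow> aexp" where "Var x \<equiv> Get x (Num 0)"

definition For :: "nat \<Rightarrow> aexp \<Rightarrow> aexp \<Rightarrow> prog \<Rightarrow> prog" where
  "For x e f P = Seq (Put x (Num 0) e)
     (While (Less (Var x) f) (Seq P (Put x (Num 0) (Add (Var x) (Num 1)))))"

text \<open>The bound \<open>f\<close> is evaluated anew at each test, hence the assumption that the
  invariant fixes its value. Restricting \<open>e\<close> and \<open>f\<close> to cost 2 makes the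
  overhead uniform: per iteration 6 steps for the test and 6 for the increment, and 10 in all for
  the initial assignment and the last test.\<close>

lemma runs_For:
  assumes "aval e s = l" "l \<le> h" "h \<le> N" "acost e \<le> 2" "acost f \<le> 2"
    and init: "I l (s(x := (s x)(0 := l)))"
    and bound: "\<And>i s'. I i s' \<Longrightarrow> aval f s' = h"
    and step: "\<And>i s'. l \<le> i \<Longrightarrow> i < h \<Longrightarrow> s' x 0 = i \<Longrightarrow> I i s' \<Longrightarrow>
      runs P s' T (\<lambda>s''. s'' x 0 = i \<and> I (Suc i) (s''(x := (s'' x)(0 := Suc i))))"
    and "N * (T + 12) + 10 \<le> T'"
  shows "runs (For x e f P) s T' (I h)"
proof -
  define J where "J = (\<lambda>i s'. s' x 0 = l + i \<and> I (l + i) s')"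
  have "runs (While (Less (Var x) f) (Seq P (Put x (Num 0) (Add (Var x) (Num 1)))))
    (s(x := (s x)(0 := l))) (N * (T + 12) + 6) (J (h - l))"
  proof (rule runs_While[where I = J and T = "T + 6"])
    show "J 0 (s(x := (s x)(0 := l)))" using init by (simp add: J_def)
  next
    fix i s' assume i: "i < h - l" and J: "J i s'"
    have "runs P s' T (\<lambda>s''. s'' x 0 = l + i \<and> I (Suc (l + i)) (s''(x := (s'' x)(0 := Suc (l + i)))))"
      using step[of "l + i" s'] i J by (simp add: J_def)
    then have "runs (Seq P (Put x (Num 0) (Add (Var x) (Num 1)))) s' (T + 6) (J (Suc i))"
      by (rule runs_Seq[where T' = 6]) (auto intro!: runs_Put simp: J_def)
    then show "bval (Less (Var x) f) s' \<and>
        runs (Seq P (Put x (Num 0) (Add (Var x) (Num 1)))) s' (T + 6) (J (Suc i))"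
      using J bound[of "l + i" s'] i by (simp add: J_def)
  next
    fix s' assume "J (h - l) s'"
    then show "\<not> bval (Less (Var x) f) s'" using bound[of h s'] \<open>l \<le> h\<close> by (simp add: J_def)
  next
    have "(h - l) * (bcost (Less (Var x) f) + (T + 6) + 1) \<le> N * (T + 12)"
      using assms by (intro mult_mono) auto
    then show "(h - l) * (bcost (Less (Var x) f) + (T + 6) + 1) + bcost (Less (Var x) f) + 1
        \<le> N * (T + 12) + 6"
      using \<open>acost f \<le> 2\<close> by simp
  qed
  then show ?thesis unfolding For_def
    using assms by (intro runs_Seq_Put[where T = "N * (T + 12) + 6"]) (auto intro: runs_mono simp: J_def)
qed

section \<open>Decompositions on indices\<close>

text \<open>Balance is built in: the lists are repetition-free, so their lengths are cardinalities,
  and one nonempty side forces the other.\<close>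

definition biclique_partition :: "(nat \<times> nat) set \<Rightarrow> (nat list \<times> nat list) list \<Rightarrow> bool" where
  "biclique_partition F I \<longleftrightarrow>
     (\<forall>(us, vs) \<in> set I. distinct us \<and> distinct vs \<and> length us = length vs \<and> us \<noteq> []) \<and>
     disjoint_family_on (\<lambda>r. set (fst (I ! r)) \<times> set (snd (I ! r))) {..<length I} \<and>
     (\<Union>(us, vs) \<in> set I. set us \<times> set vs) = F"

definition weight :: "(nat list \<times> nat list) list \<Rightarrow> nat" where
  "weight I = (\<Sum>(us, vs) \<leftarrow> I. length us + length vs)"

lemma biclique_partition_Nil: "biclique_partition {} []"
  by (simp add: biclique_partition_def disjoint_family_on_def)

lemma biclique_partition_snoc:
  assumes "biclique_partition F I" "distinct us" "distinct vs" "length us = length vs" "us \<noteq> []"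
    and "F \<inter> set us \<times> set vs = {}"
  shows "biclique_partition (F \<union> set us \<times> set vs) (I @ [(us, vs)])"
proof -
  have F: "(\<Union>(us, vs) \<in> set I. set us \<times> set vs) = F"
    and D: "disjoint_family_on (\<lambda>r. set (fst (I ! r)) \<times> set (snd (I ! r))) {..<length I}"
    using assms(1) by (auto simp: biclique_partition_def)
  have sub: "set (fst (I ! r)) \<times> set (snd (I ! r)) \<subseteq> F" if "r < length I" for r
    using F nth_mem[OF that] by (force simp: case_prod_unfold)
  have "disjoint_family_on (\<lambda>r. set (fst ((I @ [(us, vs)]) ! r)) \<times> set (snd ((I @ [(us, vs)]) ! r)))
      (insert (length I) {..<length I})"
  proof (subst disjoint_family_on_insert)
    have "disjoint_family_on (\<lambda>r. set (fst ((I @ [(us, vs)]) ! r)) \<times> set (snd ((I @ [(us, vs)]) ! r))) {..<length I}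
      = disjoint_family_on (\<lambda>r. set (fst (I ! r)) \<times> set (snd (I ! r))) {..<length I}"
      unfolding disjoint_family_on_def by (simp add: nth_append)
    moreover have "set (fst ((I @ [(us, vs)]) ! length I)) \<times> set (snd ((I @ [(us, vs)]) ! length I)) \<inter>
      (\<Union>i\<in>{..<length I}. set (fst ((I @ [(us, vs)]) ! i)) \<times> set (snd ((I @ [(us, vs)]) ! i))) = {}"
      using sub assms(6) by (fastforce simp: nth_append)
    ultimately show "set (fst ((I @ [(us, vs)]) ! length I)) \<times> set (snd ((I @ [(us, vs)]) ! length I)) \<inter>
      (\<Union>i\<in>{..<length I}. set (fst ((I @ [(us, vs)]) ! i)) \<times> set (snd ((I @ [(us, vs)]) ! i))) = {} \<and>
      disjoint_family_on (\<lambda>r. set (fst ((I @ [(us, vs)]) ! r)) \<times> set (snd ((I @ [(us, vs)]) ! r))) {..<length I}"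
      using D by blast
  qed simp
  moreover have "{..<length (I @ [(us, vs)])} = insert (length I) {..<length I}" by auto
  ultimately show ?thesis
    using assms F unfolding biclique_partition_def by (auto simp: case_prod_unfold)
qed

text \<open>Serves to return to the orientation of the input when the rows are the vertices in
  \<open>ys\<close>.\<close>

lemma biclique_partition_swap:
  assumes "biclique_partition F I"
  shows "biclique_partition (prod.swap ` F) (map prod.swap I)"
  unfolding biclique_partition_def
proof (intro conjI)
  show "\<forall>(us, vs) \<in> set (map prod.swap I). distinct us \<and> distinct vs \<and> length us = length vs \<and> us \<noteq> []"
    using assms by (fastforce simp: biclique_partition_def)
  show "disjoint_family_on (\<lambda>r. set (fst (map prod.swap I ! r)) \<times> set (snd (map prod.swap I ! r)))
     {..<length (map prod.swap I)}"
    using assms unfolding biclique_partition_def disjoint_family_on_def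
    by (simp add: Times_Int_Times) blast
  show "(\<Union>(us, vs) \<in> set (map prod.swap I). set us \<times> set vs) = prod.swap ` F"
    using assms unfolding biclique_partition_def by (auto simp: case_prod_unfold image_iff) (metis fst_conv snd_conv)+
qed

lemma weight_swap: "weight (map prod.swap I) = weight I"
  by (induction I) (auto simp: weight_def)

text \<open>Indexing a distinct list is injective on valid indices, and so is the product of two
  such maps; hence cardinalities and the disjointness of the edge sets carry over to
  vertices.\<close>

lemma decomposition_of_biclique_partition:
  assumes "biclique_partition F I" "F \<subseteq> {..<length xs} \<times> {..<length ys}" "distinct xs" "distinct ys"
  shows "decomposition (set xs) (set ys) (map_prod ((!) xs) ((!) ys) ` F)
           (map (\<lambda>(us, vs). ((!) xs ` set us, (!) ys ` set vs)) I)" (is "decomposition _ _ _ ?D")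
    and "balanced (map (\<lambda>(us, vs). ((!) xs ` set us, (!) ys ` set vs)) I)"
    and "complexity (map (\<lambda>(us, vs). ((!) xs ` set us, (!) ys ` set vs)) I) = weight I"
    and "\<forall>(us, vs) \<in> set I. distinct us \<and> set us \<subseteq> {..<length xs} \<and>
                              distinct vs \<and> set vs \<subseteq> {..<length ys}"
proof -
  have un: "(\<Union>(us, vs) \<in> set I. set us \<times> set vs) = F"
    and dis: "disjoint_family_on (\<lambda>r. set (fst (I ! r)) \<times> set (snd (I ! r))) {..<length I}"
    and I: "\<And>us vs. (us, vs) \<in> set I \<Longrightarrow> distinct us \<and> distinct vs \<and> length us = length vs \<and> us \<noteq> []"
    using assms(1) by (auto simp: biclique_partition_def)
  have sub: "set us \<times> set vs \<subseteq> F" if "(us, vs) \<in> set I" for us vs using un that by auto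
  \<comment> \<open>An inclusion of products bounds each factor only when the other is
    nonempty.\<close>
  have bnd: "set us \<subseteq> {..<length xs} \<and> set vs \<subseteq> {..<length ys}" if uv: "(us, vs) \<in> set I" for us vs
  proof -
    have "set us \<noteq> {}" "set vs \<noteq> {}" using I[OF uv] by auto
    moreover have "set us \<times> set vs \<subseteq> {..<length xs} \<times> {..<length ys}" using sub[OF uv] assms(2) by blast
    ultimately show ?thesis by (auto simp: times_subset_iff)
  qed
  have injx: "inj_on ((!) xs) {..<length xs}" and injy: "inj_on ((!) ys) {..<length ys}"
    using assms by (auto simp: inj_on_nth)
  then have injp: "inj_on (map_prod ((!) xs) ((!) ys)) ({..<length xs} \<times> {..<length ys})"
    by (rule map_prod_inj_on)
  have card: "card ((!) xs ` set us) = length us \<and> card ((!) ys ` set vs) = length vs" if uv: "(us, vs) \<in> set I" for us vs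
    using bnd[OF uv] I[OF uv] injx injy by (metis card_image distinct_card inj_on_subset)
  show "\<forall>(us, vs) \<in> set I. distinct us \<and> set us \<subseteq> {..<length xs} \<and> distinct vs \<and> set vs \<subseteq> {..<length ys}"
    using I bnd by blast
  show "balanced ?D" using card I by (auto simp: balanced_def)
  have "complexity ?D = (\<Sum>(us, vs) \<leftarrow> I. card ((!) xs ` set us) + card ((!) ys ` set vs))"
    by (simp add: complexity_def case_prod_unfold comp_def)
  also have "\<dots> = weight I"
    unfolding weight_def using card by (intro arg_cong[of _ _ sum_list] map_cong) auto
  finally show "complexity ?D = weight I" .
  show "decomposition (set xs) (set ys) (map_prod ((!) xs) ((!) ys) ` F) ?D"
    unfolding decomposition_def
  proof (intro conjI)
    have "(!) xs ` set us \<subseteq> set xs \<and> (!) ys ` set vs \<subseteq> set ys \<and>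
        (!) xs ` set us \<times> (!) ys ` set vs \<subseteq> map_prod ((!) xs) ((!) ys) ` F \<and>
        (!) xs ` set us \<times> (!) ys ` set vs \<noteq> {}" if uv: "(us, vs) \<in> set I" for us vs
    proof (intro conjI)
      show "(!) xs ` set us \<times> (!) ys ` set vs \<noteq> {}" using I[OF uv] by auto
      show "(!) xs ` set us \<times> (!) ys ` set vs \<subseteq> map_prod ((!) xs) ((!) ys) ` F"
        using sub[OF uv] by (auto simp: image_iff)
    qed (use bnd[OF uv] in auto)
    then show "\<forall>(X, Y) \<in> set ?D. X \<subseteq> set xs \<and> Y \<subseteq> set ys \<and> X \<times> Y \<subseteq> map_prod ((!) xs) ((!) ys) ` F \<and> X \<times> Y \<noteq> {}"
      unfolding set_map by (simp only: ball_simps case_prod_unfold fst_conv snd_conv) (metis prod.collapse)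
    have "(\<Union>(X, Y) \<in> set ?D. X \<times> Y) = map_prod ((!) xs) ((!) ys) ` (\<Union>(us, vs) \<in> set I. set us \<times> set vs)"
      by (simp add: image_UN case_prod_unfold map_prod_surj_on[OF refl refl])
    then show "(\<Union>(X, Y) \<in> set ?D. X \<times> Y) = map_prod ((!) xs) ((!) ys) ` F" using un by simp
    have e: "fst (?D ! r) \<times> snd (?D ! r) = map_prod ((!) xs) ((!) ys) ` (set (fst (I ! r)) \<times> set (snd (I ! r)))"
      if "r < length I" for r
      using that by (simp add: case_prod_unfold map_prod_surj_on[OF refl refl])
    have s: "set (fst (I ! r)) \<times> set (snd (I ! r)) \<subseteq> {..<length xs} \<times> {..<length ys}" if "r < length I" for r
      using sub[of "fst (I ! r)" "snd (I ! r)"] nth_mem[OF that] assms(2) by auto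
    show "disjoint_family_on (\<lambda>r. fst (?D ! r) \<times> snd (?D ! r)) {..<length ?D}"
      unfolding disjoint_family_on_def
    proof (intro ballI impI)
      fix q r assume qr: "q \<in> {..<length ?D}" "r \<in> {..<length ?D}" "q \<noteq> r"
      then have "(set (fst (I ! q)) \<times> set (snd (I ! q))) \<inter> (set (fst (I ! r)) \<times> set (snd (I ! r))) = {}"
        using dis by (auto simp: disjoint_family_on_def)
      then show "fst (?D ! q) \<times> snd (?D ! q) \<inter> (fst (?D ! r) \<times> snd (?D ! r)) = {}"
        using qr s e inj_on_image_Int[OF injp, of "set (fst (I ! q)) \<times> set (snd (I ! q))" "set (fst (I ! r)) \<times> set (snd (I ! r))"]
        by simp
    qed
  qed
qed

section \<open>Processing a block of rows\<close>

definition pat :: "(nat \<times> nat) set \<Rightarrow> nat \<Rightarrow> nat \<Rightarrow> nat \<Rightarrow> nat set" where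
  "pat M l h j = {i \<in> {l..<h}. (i, j) \<in> M}"

text \<open>A relation, so that the counting does not depend on which columns of the class are
  chosen. Only columns from \<open>j\<close> on are searched; \<open>block_inv_step\<close> shows
  that this loses nothing.\<close>

definition pivot_step ::
  "nat \<Rightarrow> nat \<Rightarrow> nat \<Rightarrow> nat \<Rightarrow> (nat \<times> nat) set \<Rightarrow> (nat list \<times> nat list) list \<Rightarrow>
   (nat \<times> nat) set \<Rightarrow> (nat list \<times> nat list) list \<Rightarrow> bool" where
  "pivot_step n l h j M I M' I' \<longleftrightarrow>
     M' = M \<and> I' = I \<and>
       (pat M l h j = {} \<or> card {j' \<in> {j..<n}. pat M l h j' = pat M l h j} < card (pat M l h j)) \<or>
     (\<exists>us vs. I' = I @ [(us, vs)] \<and> M' = M - set us \<times> set vs \<and> distinct us \<and> distinct vs \<and>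
        length us = length vs \<and> us \<noteq> [] \<and> set us = pat M l h j \<and> j \<in> set vs \<and>
        set vs \<subseteq> {j' \<in> {j..<n}. pat M l h j' = pat M l h j})"

text \<open>All columns are counted here, unlike in \<open>pivot_step\<close>. The condition depends
  on \<open>j\<close> only through its pattern, so it passes between columns with equal
  patterns.\<close>

definition exhausted :: "nat \<Rightarrow> nat \<Rightarrow> nat \<Rightarrow> (nat \<times> nat) set \<Rightarrow> nat \<Rightarrow> bool" where
  "exhausted n l h M j \<longleftrightarrow> pat M l h j = {} \<or>
     card {j' \<in> {..<n}. pat M l h j' = pat M l h j} < card (pat M l h j)"

text \<open>The two inequalities bound the weight of the graphs split off: by twice the number of columns
  whose pattern has become empty, and by twice the number of edges removed.\<close>

definition block_inv ::
  "nat \<Rightarrow> nat \<Rightarrow> nat \<Rightarrow> (nat \<times> nat) set \<Rightarrow> (nat \<times> nat) set \<Rightarrow> nat \<Rightarrow> nat \<Rightarrow>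
   (nat \<times> nat) set \<Rightarrow> (nat list \<times> nat list) list \<Rightarrow> bool" where
  "block_inv n l h M0 M1 w j M I \<longleftrightarrow> M \<subseteq> M1 \<and> M1 - M \<subseteq> {l..<h} \<times> UNIV \<and>
     biclique_partition (M0 - M) I \<and>
     weight I + 2 * card {j' \<in> {..<n}. pat M l h j' \<noteq> {}} \<le> w + 2 * n \<and>
     weight I + 2 * card M \<le> w + 2 * card M1 \<and>
     (\<forall>j'<j. exhausted n l h M j')"

lemma weight_snoc: "weight (I @ [(us, vs)]) = weight I + (length us + length vs)"
  by (simp add: weight_def)

lemma block_inv_init:
  assumes "biclique_partition (M0 - M) I"
  shows "block_inv n l h M0 M (weight I) 0 M I"
proof -
  have "card {j' \<in> {..<n}. pat M l h j' \<noteq> {}} \<le> card {..<n}" by (rule card_mono) auto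
  then show ?thesis using assms by (simp add: block_inv_def)
qed

text \<open>The rows removed are exactly the pattern shared by the chosen columns, so these columns
  become empty and all other patterns stay as they are. Hence no class of a nonempty pattern grows,
  and exhaustion persists.\<close>

lemma block_inv_step:
  assumes inv: "block_inv n l h M0 M1 w j M I" and st: "pivot_step n l h j M I M' I'"
    and "j < n" "finite M1" "M1 \<subseteq> M0"
  shows "block_inv n l h M0 M1 w (Suc j) M' I'"
proof -
  have MM: "M \<subseteq> M1" using inv by (simp add: block_inv_def)
  then have finM: "finite M" and MM0: "M \<subseteq> M0" using assms(4,5) by (auto intro: finite_subset)
  from st consider
    (idle) "M' = M" "I' = I" "pat M l h j = {} \<or> card {j' \<in> {j..<n}. pat M l h j' = pat M l h j} < card (pat M l h j)"
  | (emit) us vs where "I' = I @ [(us, vs)]" "M' = M - set us \<times> set vs" "distinct us" "distinct vs"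
        "length us = length vs" "us \<noteq> []" "set us = pat M l h j" "j \<in> set vs"
        "set vs \<subseteq> {j' \<in> {j..<n}. pat M l h j' = pat M l h j}"
    unfolding pivot_step_def by blast
  then show ?thesis
  proof cases
    case idle
    have "exhausted n l h M j"
    \<comment> \<open>An earlier column with this pattern is exhausted already; without one, the
      whole class lies in the columns from \<open>j\<close> on, which the idle test has
      counted.\<close>
    proof (cases "\<exists>j'<j. pat M l h j' = pat M l h j")
      case True
      then show ?thesis using inv by (auto simp: block_inv_def exhausted_def)
    next
      case False
      then have "{j' \<in> {..<n}. pat M l h j' = pat M l h j} = {j' \<in> {j..<n}. pat M l h j' = pat M l h j}"
        by (auto simp: not_less[symmetric])
      then show ?thesis using idle by (simp add: exhausted_def)
    qed
    then show ?thesis using inv idle by (auto simp: block_inv_def less_Suc_eq)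
  next
    case emit
    have cl: "set vs \<subseteq> {..<n}" "\<And>c. c \<in> set vs \<Longrightarrow> pat M l h c = set us" using emit by auto
    have sub: "set us \<times> set vs \<subseteq> M" using cl unfolding pat_def by blast
    have rowsub: "set us \<subseteq> {l..<h}" using emit by (auto simp: pat_def)
    have pat': "pat M' l h c = (if c \<in> set vs then {} else pat M l h c)" for c
      using emit cl(2)[of c] by (auto simp: pat_def)
    have ne: "set us \<noteq> {}" using \<open>us \<noteq> []\<close> by (cases us) auto
    have cu: "card (set us) = length us" "card (set vs) = length us"
      using distinct_card[OF emit(3)] distinct_card[OF emit(4)] emit(5) by simp_all
    have cardM: "card M = card M' + length us * length us"
      using card_Diff_subset[OF _ sub] card_mono[OF finM sub] cu unfolding emit(2) by (simp add: card_cartesian_product)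
    have "{j' \<in> {..<n}. pat M' l h j' \<noteq> {}} = {j' \<in> {..<n}. pat M l h j' \<noteq> {}} - set vs"
      by (auto simp: pat')
    moreover have sv: "set vs \<subseteq> {j' \<in> {..<n}. pat M l h j' \<noteq> {}}" using cl ne by auto
    ultimately have cardP: "card {j' \<in> {..<n}. pat M l h j' \<noteq> {}} = card {j' \<in> {..<n}. pat M' l h j' \<noteq> {}} + length us"
      using card_Diff_subset[OF _ sv] card_mono[OF _ sv] cu by simp
    have w: "weight I' = weight I + 2 * length us" using emit by (simp add: weight_snoc)
    \<comment> \<open>The graph costs \<open>2 * length us\<close> and removes
      \<open>length us * length us\<close> edges, so its weight is paid for by the edges.\<close>
    have le: "length us \<le> length us * length us" by (rule le_square)
    have "biclique_partition ((M0 - M) \<union> set us \<times> set vs) I'"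
      unfolding emit(1) using inv emit sub by (intro biclique_partition_snoc) (auto simp: block_inv_def)
    moreover have "(M0 - M) \<union> set us \<times> set vs = M0 - M'"
      using sub MM0 unfolding emit(2) by blast
    ultimately have bp: "biclique_partition (M0 - M') I'" by simp
    have ex: "exhausted n l h M' c" if c: "c < Suc j" for c
    proof (cases "c \<in> set vs")
      case True
      then show ?thesis by (simp add: exhausted_def pat')
    next
      case False
      then have "c < j" using c emit by (metis less_SucE)
      then have e: "exhausted n l h M c" using inv by (simp add: block_inv_def)
      \<comment> \<open>Nonemptiness matters: the class of the empty pattern does grow.\<close>
      have "card {j' \<in> {..<n}. pat M' l h j' = pat M l h c} \<le> card {j' \<in> {..<n}. pat M l h j' = pat M l h c}"
        if "pat M l h c \<noteq> {}"
        using that by (intro card_mono) (auto simp: pat' split: if_splits)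
      moreover have "pat M' l h c = pat M l h c" using False by (simp add: pat')
      ultimately show ?thesis using e unfolding exhausted_def by fastforce
    qed
    show ?thesis unfolding block_inv_def
    proof (intro conjI)
      show "M' \<subseteq> M1" "M1 - M' \<subseteq> {l..<h} \<times> UNIV"
        using inv rowsub unfolding emit(2) block_inv_def by blast+
      show "weight I' + 2 * card {j' \<in> {..<n}. pat M' l h j' \<noteq> {}} \<le> w + 2 * n"
        using inv cardP w by (simp add: block_inv_def)
      show "weight I' + 2 * card M' \<le> w + 2 * card M1"
        using inv cardM w le unfolding block_inv_def by linarith
    qed (use bp ex in auto)
  qed
qed

text \<open>The edges are sorted by the pattern \<open>S\<close> of their column. A nonempty
  \<open>S\<close> that occurs has at most \<open>k\<close> rows and fewer columns than rows, at
  most \<open>k - 1\<close>; the empty pattern may have many columns but carries no edge.\<close>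

lemma exhausted_card:
  assumes "\<And>j. j < n \<Longrightarrow> exhausted n l h M j" "M \<subseteq> UNIV \<times> {..<n}" "h - l \<le> k"
  shows "card (M \<inter> {l..<h} \<times> UNIV) \<le> 2 ^ k * (k * (k - 1))"
proof -
  let ?cls = "\<lambda>S. {j \<in> {..<n}. pat M l h j = S}"
  have fin: "finite (Pow {l..<h})" by simp
  have "M \<inter> {l..<h} \<times> UNIV \<subseteq> (\<Union>S\<in>Pow {l..<h}. S \<times> ?cls S)"
  proof
    fix p assume p: "p \<in> M \<inter> {l..<h} \<times> UNIV"
    then have "fst p \<in> pat M l h (snd p)" "snd p < n" using assms(2) by (auto simp: pat_def)
    moreover have "pat M l h (snd p) \<in> Pow {l..<h}" by (auto simp: pat_def)
    ultimately show "p \<in> (\<Union>S\<in>Pow {l..<h}. S \<times> ?cls S)"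
      by (intro UN_I[of "pat M l h (snd p)"]) (auto simp: mem_Times_iff)
  qed
  then have "card (M \<inter> {l..<h} \<times> UNIV) \<le> card (\<Union>S\<in>Pow {l..<h}. S \<times> ?cls S)"
  proof (rule card_mono[rotated], intro finite_UN_I finite_cartesian_product)
    show "finite S" if "S \<in> Pow {l..<h}" for S using that by (auto intro: finite_subset)
  qed simp_all
  also have "\<dots> \<le> (\<Sum>S\<in>Pow {l..<h}. card (S \<times> ?cls S))"
    by (rule card_UN_le) simp
  also have "\<dots> \<le> (\<Sum>S\<in>Pow {l..<h}. k * (k - 1))"
  proof (rule sum_mono)
    fix S assume S: "S \<in> Pow {l..<h}"
    then have cS: "card S \<le> k" using card_mono[of "{l..<h}" S] assms(3) by simp
    show "card (S \<times> ?cls S) \<le> k * (k - 1)"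
    proof (cases "S = {} \<or> ?cls S = {}")
      case False
      then obtain j where j: "j < n" "pat M l h j = S" by blast
      with assms(1)[of j] False have "card (?cls S) < card S" by (simp add: exhausted_def)
      then have "card (?cls S) \<le> k - 1" using cS by simp
      then show ?thesis using cS by (simp add: card_cartesian_product mult_le_mono)
    next
      case True
      then have "S \<times> ?cls S = {}" by blast
      then show ?thesis by (simp only: card.empty le0)
    qed
  qed
  also have "\<dots> = 2 ^ (h - l) * (k * (k - 1))" by (simp add: card_Pow)
  also have "\<dots> \<le> 2 ^ k * (k * (k - 1))" using assms(3) by (intro mult_right_mono power_increasing) auto
  finally show ?thesis .
qed

text \<open>\<open>M1\<close> and \<open>w\<close> are the edge set and the weight at the start of a
  round, and \<open>t\<close> counts finished blocks. The weight bound by columns serves the first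
  round, the one by edges the second.\<close>

definition blocks_inv ::
  "nat \<Rightarrow> nat \<Rightarrow> nat \<Rightarrow> (nat \<times> nat) set \<Rightarrow> (nat \<times> nat) set \<Rightarrow> nat \<Rightarrow> nat \<Rightarrow>
   (nat \<times> nat) set \<Rightarrow> (nat list \<times> nat list) list \<Rightarrow> bool" where
  "blocks_inv n k m M0 M1 w t M I \<longleftrightarrow> M \<subseteq> M1 \<and> biclique_partition (M0 - M) I \<and>
     weight I \<le> w + t * (2 * n) \<and> weight I + 2 * card M \<le> w + 2 * card M1 \<and>
     card (M \<inter> {..<min (t * k) m} \<times> UNIV) \<le> t * (2 ^ k * (k * (k - 1)))"

text \<open>The block invariant starts from the current \<open>M\<close> and
  \<open>weight I\<close>, so its bounds add to those accumulated; finished rows can only lose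
  edges.\<close>

lemma blocks_inv_step:
  assumes B: "blocks_inv n k m M0 M1 w t M I" and b: "block_inv n (t * k) h M0 M (weight I) n M' I'"
    and h: "h = min (Suc t * k) m" and "t * k < m" and "M1 \<subseteq> {..<m} \<times> {..<n}"
  shows "blocks_inv n k m M0 M1 w (Suc t) M' I'"
proof -
  let ?C = "2 ^ k * (k * (k - 1))"
  have MM: "M' \<subseteq> M" "M \<subseteq> M1" using B b by (auto simp: blocks_inv_def block_inv_def)
  have finM: "finite M" using MM assms(5) by (meson finite_SigmaI finite_lessThan finite_subset)
  have "card (M' \<inter> {t * k..<h} \<times> UNIV) \<le> ?C"
  proof (rule exhausted_card)
    show "exhausted n (t * k) h M' j" if "j < n" for j using b that by (simp add: block_inv_def)
    show "M' \<subseteq> UNIV \<times> {..<n}" using MM assms(5) by blast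
    show "h - t * k \<le> k" using h by simp
  qed
  moreover have "card (M' \<inter> {..<min (t * k) m} \<times> UNIV) \<le> card (M \<inter> {..<min (t * k) m} \<times> UNIV)"
    using MM finM by (intro card_mono) auto
  moreover have "M' \<inter> {..<min (Suc t * k) m} \<times> UNIV
      = (M' \<inter> {..<min (t * k) m} \<times> UNIV) \<union> (M' \<inter> {t * k..<h} \<times> UNIV)"
  proof -
    have "{..<min (Suc t * k) m} = {..<min (t * k) m} \<union> {t * k..<h}" using h assms(4) by auto
    then show ?thesis by blast
  qed
  ultimately have "card (M' \<inter> {..<min (Suc t * k) m} \<times> UNIV) \<le> Suc t * ?C"
    using B card_Un_le[of "M' \<inter> {..<min (t * k) m} \<times> UNIV" "M' \<inter> {t * k..<h} \<times> UNIV"]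
    by (simp add: blocks_inv_def)
  moreover have "weight I' \<le> w + Suc t * (2 * n)" "weight I' + 2 * card M' \<le> w + 2 * card M1"
    using B b by (simp_all add: blocks_inv_def block_inv_def)
  ultimately show ?thesis using b MM unfolding blocks_inv_def block_inv_def by blast
qed

section \<open>The program\<close>

text \<open>Numbers of the arrays; those from \<open>height\<close> on serve as scalar variables, held in cell 0.
  The entry in row \<open>i\<close> and column \<open>j\<close> is found at \<open>row_offset[i] + col_offset[j]\<close>, so that the smaller
  class can play the role of the rows without transposing the matrix.\<close>

abbreviation (input) "sizes \<equiv> 0 :: nat"
abbreviation (input) "matrix \<equiv> 1 :: nat"
abbreviation (input) "outp \<equiv> 2 :: nat"
abbreviation (input) "row_offset \<equiv> 3 :: nat"
abbreviation (input) "col_offset \<equiv> 4 :: nat"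
abbreviation (input) "rows \<equiv> 5 :: nat"
abbreviation (input) "cols \<equiv> 6 :: nat"
abbreviation (input) "height \<equiv> 7 :: nat"
abbreviation (input) "width \<equiv> 8 :: nat"
abbreviation (input) "swapped \<equiv> 9 :: nat"
abbreviation (input) "row_step \<equiv> 10 :: nat"
abbreviation (input) "col_step \<equiv> 11 :: nat"
abbreviation (input) "block_size \<equiv> 12 :: nat"
abbreviation (input) "power4 \<equiv> 13 :: nat"
abbreviation (input) "lo \<equiv> 14 :: nat"
abbreviation (input) "hi \<equiv> 15 :: nat"
abbreviation (input) "pivot \<equiv> 16 :: nat"
abbreviation (input) "row \<equiv> 17 :: nat"
abbreviation (input) "col \<equiv> 18 :: nat"
abbreviation (input) "num_rows \<equiv> 19 :: nat"
abbreviation (input) "num_cols \<equiv> 20 :: nat"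
abbreviation (input) "same \<equiv> 21 :: nat"
abbreviation (input) "out_end \<equiv> 22 :: nat"
abbreviation (input) "idx \<equiv> 23 :: nat"
abbreviation (input) "idx2 \<equiv> 24 :: nat"

abbreviation Entry :: "aexp \<Rightarrow> aexp \<Rightarrow> aexp" where
  "Entry i j \<equiv> Get matrix (Add (Get row_offset i) (Get col_offset j))"

abbreviation Set :: "nat \<Rightarrow> aexp \<Rightarrow> prog" where
  "Set x e \<equiv> Put x (Num 0) e"

text \<open>The counter advances by the entry 0 or 1, so a row that is not a neighbour is overwritten
  by the next one.\<close>

definition collect_rows :: prog where
  "collect_rows = Seq (Set num_rows (Num 0)) (For row (Var lo) (Var hi)
     (Seq (Put rows (Var num_rows) (Var row))
          (Set num_rows (Add (Var num_rows) (Entry (Var row) (Var pivot))))))"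

text \<open>With truncated subtraction, \<open>(x - y) + (y - x)\<close> is the distance of two
  entries, so \<open>same\<close> drops to 0 at the first difference and stays there without any
  branch.\<close>

definition compare_columns :: prog where
  "compare_columns = Seq (Set same (Num 1)) (For row (Var lo) (Var hi)
     (Set same (Sub (Var same)
       (Add (Sub (Entry (Var row) (Var col)) (Entry (Var row) (Var pivot)))
            (Sub (Entry (Var row) (Var pivot)) (Entry (Var row) (Var col)))))))"

text \<open>The flag \<open>same\<close> advances the counter as the entry does in
  \<open>collect_rows\<close>. The scan starts at the pivot, which is therefore the first column
  collected.\<close>

definition collect_cols :: prog where
  "collect_cols = Seq (Set num_cols (Num 0)) (For col (Var pivot) (Var width)
     (Seq compare_columns (Seq (Put cols (Var num_cols) (Var col))
        (Set num_cols (Add (Var num_cols) (Var same))))))"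

text \<open>The length is \<open>num_rows\<close> for columns too: balance requires just the first
  \<open>num_rows\<close> of the collected columns.\<close>

definition write_list :: "nat \<Rightarrow> prog" where
  "write_list k = Seq (Put outp (Var out_end) (Var num_rows))
     (Seq (Set out_end (Add (Var out_end) (Num 1)))
     (For idx (Num 0) (Var num_rows)
       (Seq (Put outp (Var out_end) (Get k (Var idx)))
            (Set out_end (Add (Var out_end) (Num 1))))))"

definition clear_edges :: prog where
  "clear_edges = For idx (Num 0) (Var num_rows) (For idx2 (Num 0) (Var num_rows)
     (Put matrix (Add (Get row_offset (Get rows (Var idx))) (Get col_offset (Get cols (Var idx2)))) (Num 0)))"

definition emit :: prog where
  "emit = Seq (Cond (Less (Num 0) (Var swapped))
       (Seq (write_list cols) (write_list rows)) (Seq (write_list rows) (write_list cols)))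
     (Seq (Set outp (Add (Var outp) (Num 1))) clear_edges)"

definition process_pivot :: prog where
  "process_pivot = Seq collect_rows (Seq collect_cols
     (Cond (Conj (Less (Num 0) (Var num_rows)) (Neg (Less (Var num_cols) (Var num_rows)))) emit Skip))"

definition process_blocks :: prog where
  "process_blocks = Seq (Set lo (Num 0)) (While (Less (Var lo) (Var height))
     (Seq (Cond (Less (Add (Var lo) (Var block_size)) (Var height))
            (Set hi (Add (Var lo) (Var block_size))) (Set hi (Var height)))
     (Seq (For pivot (Num 0) (Var width) process_pivot)
          (Set lo (Add (Var lo) (Var block_size))))))"

text \<open>The machine cannot multiply, so the multiples of the step are built by repeated
  addition, starting from the 0 that cell 0 holds initially.\<close>

definition fill_offsets :: "nat \<Rightarrow> nat \<Rightarrow> nat \<Rightarrow> prog" where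
  "fill_offsets k d z = For row (Num 0) (Var z)
     (Put k (Add (Var row) (Num 1)) (Add (Get k (Var row)) (Var d)))"

text \<open>In the input the address of an entry is the index in \<open>xs\<close> times the length
  of \<open>ys\<close>, plus the index in \<open>ys\<close>; exchanging the classes exchanges the
  two steps.\<close>

definition choose_layout :: prog where
  "choose_layout = Cond (Less (Get sizes (Num 1)) (Get sizes (Num 0)))
     (Seq (Set swapped (Num 1))
     (Seq (Set height (Get sizes (Num 1))) (Seq (Set width (Get sizes (Num 0)))
     (Seq (Set row_step (Num 1)) (Set col_step (Get sizes (Num 1)))))))
     (Seq (Set swapped (Num 0))
     (Seq (Set height (Get sizes (Num 0))) (Seq (Set width (Get sizes (Num 1)))
     (Seq (Set row_step (Get sizes (Num 1))) (Set col_step (Num 1))))))"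

definition choose_block_size :: prog where
  "choose_block_size = Seq (Set block_size (Num 1)) (Seq (Set power4 (Num 4))
     (While (Neg (Less (Var width) (Var power4)))
       (Seq (Set power4 (Add (Add (Var power4) (Var power4)) (Add (Var power4) (Var power4))))
            (Set block_size (Add (Var block_size) (Num 1))))))"

text \<open>In the second round the blocks are single rows, and the graphs split off are single edges.\<close>

definition find_decomposition :: prog where
  "find_decomposition = Seq choose_layout (Seq (fill_offsets row_offset row_step height)
     (Seq (fill_offsets col_offset col_step width) (Seq (Set out_end (Num 1))
     (Seq choose_block_size (Seq process_blocks (Seq (Set block_size (Num 1)) process_blocks))))))"

section \<open>Correctness of the subroutines\<close>

text \<open>Framing by whole arrays is fine enough, since every scalar has an array to
  itself.\<close>

definition frame :: "nat set \<Rightarrow> memory \<Rightarrow> memory \<Rightarrow> bool" where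
  "frame F s s' \<longleftrightarrow> (\<forall>y. y \<notin> F \<longrightarrow> s' y = s y)"

lemma frame_refl: "frame F s s"
  by (simp add: frame_def)

lemma frame_trans: "frame F s s' \<Longrightarrow> frame F' s' s'' \<Longrightarrow> F \<union> F' \<subseteq> F'' \<Longrightarrow> frame F'' s s''"
  unfolding frame_def by (metis UnI1 UnI2 subsetD)

lemma frame_upd: "x \<in> F \<Longrightarrow> frame F s (s'(x := v)) \<longleftrightarrow> frame F s s'"
  by (auto simp: frame_def)

text \<open>Abstracts from the orientation: \<open>rs\<close> and \<open>cs\<close> are the address
  steps, and injectivity lets one entry be cleared without affecting others. \<open>N\<close> bounds
  the lengths of the loops in the time estimates.\<close>

locale layout =
  fixes m n rs cs :: nat and sw :: bool and N :: nat
  assumes inj: "inj_on (\<lambda>(i, j). i * rs + j * cs) ({..<m} \<times> {..<n})"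
    and m_le: "m \<le> N" and n_le: "n \<le> N"
begin

definition env :: "memory \<Rightarrow> bool" where
  "env s \<longleftrightarrow> s height 0 = m \<and> s width 0 = n \<and> s swapped 0 = of_bool sw \<and>
     (\<forall>i<m. s row_offset i = i * rs) \<and> (\<forall>j<n. s col_offset j = j * cs)"

definition stores :: "(nat \<times> nat) set \<Rightarrow> memory \<Rightarrow> bool" where
  "stores M s \<longleftrightarrow> M \<subseteq> {..<m} \<times> {..<n} \<and>
     (\<forall>i<m. \<forall>j<n. s matrix (i * rs + j * cs) = of_bool ((i, j) \<in> M))"

text \<open>If \<open>sw\<close> holds, the rows are the vertices in \<open>ys\<close>, so the output lists the columns first.\<close>

definition written :: "(nat list \<times> nat list) list \<Rightarrow> memory \<Rightarrow> bool" where
  "written I s \<longleftrightarrow> s outp 0 = length I \<and> 1 \<le> s out_end 0 \<and>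
     map (s outp) [1..<s out_end 0] =
       concat (map (\<lambda>(us, vs). length us # us @ length vs # vs) (if sw then map prod.swap I else I))"

lemma env_frame: "frame F s s' \<Longrightarrow> F \<inter> {height, width, swapped, row_offset, col_offset} = {} \<Longrightarrow> env s' = env s"
  by (simp add: env_def frame_def)

lemma stores_frame: "frame F s s' \<Longrightarrow> matrix \<notin> F \<Longrightarrow> stores M s' = stores M s"
  by (simp add: stores_def frame_def)

lemma written_frame: "frame F s s' \<Longrightarrow> outp \<notin> F \<Longrightarrow> out_end \<notin> F \<Longrightarrow> written M s' = written M s"
  by (simp add: written_def frame_def)

text \<open>Of the 30 steps per row, 5 write the index, 13 add the entry to the counter and 12 are
  loop overhead.\<close>

lemma collect_rows_runs:
  assumes "env s" "stores M s" "s lo 0 = l" "s hi 0 = h" "s pivot 0 = j" "l \<le> h" "h \<le> m" "j < n"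
  shows "runs collect_rows s (30 * N + 13)
    (\<lambda>s'. frame {rows, num_rows, row} s s' \<and>
          map (s' rows) [0..<s' num_rows 0] = filter (\<lambda>i. (i, j) \<in> M) [l..<h])"
  unfolding collect_rows_def
proof (rule runs_Seq_Put[where T = "30 * N + 10"], simp,
       rule runs_For[where I = "\<lambda>i s'. frame {rows, num_rows, row} s s' \<and>
          map (s' rows) [0..<s' num_rows 0] = filter (\<lambda>i. (i, j) \<in> M) [l..<i]"
          and T = 18 and l = l and h = h and N = N])
  fix i s' assume i: "l \<le> i" "i < h" "s' row 0 = i" and I: "frame {rows, num_rows, row} s s' \<and>
          map (s' rows) [0..<s' num_rows 0] = filter (\<lambda>i. (i, j) \<in> M) [l..<i]"
  have e: "aval (Entry (Var row) (Var pivot)) s' = of_bool ((i, j) \<in> M)"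
    using I assms i by (simp add: frame_def env_def stores_def)
  let ?s = "s'(rows := (s' rows)(s' num_rows 0 := i))"
  \<comment> \<open>The write goes just past the collected prefix and leaves it intact.\<close>
  have m: "map ((s' rows)(s' num_rows 0 := i)) [0..<s' num_rows 0] = filter (\<lambda>i. (i, j) \<in> M) [l..<i]"
    using I by simp
  show "runs (Seq (Put rows (Var num_rows) (Var row)) (Set num_rows (Add (Var num_rows) (Entry (Var row) (Var pivot)))))
     s' 18 (\<lambda>s''. s'' row 0 = i \<and> frame {rows, num_rows, row} s (s''(row := (s'' row)(0 := Suc i))) \<and>
       map ((s''(row := (s'' row)(0 := Suc i))) rows) [0..<(s''(row := (s'' row)(0 := Suc i))) num_rows 0]
         = filter (\<lambda>i. (i, j) \<in> M) [l..<Suc i])"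
    by (rule runs_Seq_Put[where T = 13], simp, rule runs_Put, simp)
       (use i I e m in \<open>simp add: frame_upd\<close>)
qed (use assms m_le in \<open>auto simp: frame_upd frame_refl frame_def\<close>)

lemma compare_columns_runs:
  assumes "env s" "stores M s" "s lo 0 = l" "s hi 0 = h" "s pivot 0 = j" "s col 0 = j'"
    "l \<le> h" "h \<le> m" "j < n" "j' < n"
  shows "runs compare_columns s (52 * N + 13)
    (\<lambda>s'. frame {same, row} s s' \<and>
          s' same 0 = of_bool (\<forall>i\<in>{l..<h}. (i, j') \<in> M \<longleftrightarrow> (i, j) \<in> M))"
  unfolding compare_columns_def
proof (rule runs_Seq_Put[where T = "52 * N + 10"], simp,
       rule runs_For[where I = "\<lambda>k s'. frame {same, row} s s' \<and>
          s' same 0 = of_bool (\<forall>i\<in>{l..<k}. (i, j') \<in> M \<longleftrightarrow> (i, j) \<in> M)"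
          and T = 40 and l = l and h = h and N = N])
  fix i s' assume i: "l \<le> i" "i < h" "s' row 0 = i" and I: "frame {same, row} s s' \<and>
          s' same 0 = of_bool (\<forall>i\<in>{l..<i}. (i, j') \<in> M \<longleftrightarrow> (i, j) \<in> M)"
  have e: "s' matrix (s' row_offset i + s' col_offset (s' pivot 0)) = of_bool ((i, j) \<in> M)"
    "s' matrix (s' row_offset i + s' col_offset (s' col 0)) = of_bool ((i, j') \<in> M)"
    using I assms i by (simp_all add: frame_def env_def stores_def)
  have "{l..<Suc i} = insert i {l..<i}" using i by auto
  then show "runs (Set same (Sub (Var same)
       (Add (Sub (Entry (Var row) (Var col)) (Entry (Var row) (Var pivot)))
            (Sub (Entry (Var row) (Var pivot)) (Entry (Var row) (Var col))))))
     s' 40 (\<lambda>s''. s'' row 0 = i \<and> frame {same, row} s (s''(row := (s'' row)(0 := Suc i))) \<and>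
       (s''(row := (s'' row)(0 := Suc i))) same 0 = of_bool (\<forall>i\<in>{l..<Suc i}. (i, j') \<in> M \<longleftrightarrow> (i, j) \<in> M))"
    by (intro runs_Put) (use i I in \<open>simp_all add: frame_upd e del: One_nat_def\<close>)
qed (use assms m_le in \<open>auto simp: frame_upd frame_refl frame_def\<close>)

lemma collect_cols_runs:
  assumes "env s" "stores M s" "s lo 0 = l" "s hi 0 = h" "s pivot 0 = j" "l \<le> h" "h \<le> m" "j < n"
  shows "runs collect_cols s (N * (52 * N + 37) + 13)
    (\<lambda>s'. frame {cols, num_cols, same, row, col} s s' \<and>
          map (s' cols) [0..<s' num_cols 0] =
            filter (\<lambda>j'. \<forall>i\<in>{l..<h}. (i, j') \<in> M \<longleftrightarrow> (i, j) \<in> M) [j..<n])"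
  unfolding collect_cols_def
proof (rule runs_Seq_Put[where T = "N * (52 * N + 37) + 10"], simp,
       rule runs_For[where I = "\<lambda>k s'. frame {cols, num_cols, same, row, col} s s' \<and>
          map (s' cols) [0..<s' num_cols 0] =
            filter (\<lambda>j'. \<forall>i\<in>{l..<h}. (i, j') \<in> M \<longleftrightarrow> (i, j) \<in> M) [j..<k]"
          and T = "52 * N + 25" and l = j and h = n and N = N])
  fix k s' assume k: "j \<le> k" "k < n" "s' col 0 = k"
    and I: "frame {cols, num_cols, same, row, col} s s' \<and>
          map (s' cols) [0..<s' num_cols 0] =
            filter (\<lambda>j'. \<forall>i\<in>{l..<h}. (i, j') \<in> M \<longleftrightarrow> (i, j) \<in> M) [j..<k]"
  then have I': "frame {cols, num_cols, same, row, col} s s'" by simp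
  have "env s'" "stores M s'"
    using env_frame[OF I'] stores_frame[OF I'] assms by simp_all
  moreover have "s' lo 0 = l" "s' hi 0 = h" "s' pivot 0 = j"
    using assms I' by (simp_all add: frame_def)
  ultimately have c: "runs compare_columns s' (52 * N + 13)
    (\<lambda>s'a. frame {same, row} s' s'a \<and> s'a same 0 = of_bool (\<forall>i\<in>{l..<h}. (i, k) \<in> M \<longleftrightarrow> (i, j) \<in> M))"
    using compare_columns_runs[of s' M l h j k] k assms by simp
  show "runs (Seq compare_columns (Seq (Put cols (Var num_cols) (Var col))
        (Set num_cols (Add (Var num_cols) (Var same))))) s' (52 * N + 25)
     (\<lambda>s''. s'' col 0 = k \<and>
        frame {cols, num_cols, same, row, col} s (s''(col := (s'' col)(0 := Suc k))) \<and>
       map ((s''(col := (s'' col)(0 := Suc k))) cols) [0..<(s''(col := (s'' col)(0 := Suc k))) num_cols 0]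
         = filter (\<lambda>j'. \<forall>i\<in>{l..<h}. (i, j') \<in> M \<longleftrightarrow> (i, j) \<in> M) [j..<Suc k])"
  proof (rule runs_Seq[OF c, where T' = 12])
    fix s1 assume s1: "frame {same, row} s' s1 \<and> s1 same 0 = of_bool (\<forall>i\<in>{l..<h}. (i, k) \<in> M \<longleftrightarrow> (i, j) \<in> M)"
    then have F: "frame {cols, num_cols, same, row, col} s s1"
      using I by (auto intro: frame_trans)
    have m: "map (s1 cols) [0..<s1 num_cols 0] = filter (\<lambda>j'. \<forall>i\<in>{l..<h}. (i, j') \<in> M \<longleftrightarrow> (i, j) \<in> M) [j..<k]"
      "s1 col 0 = k"
      using s1 I k by (simp_all add: frame_def)
    show "runs (Seq (Put cols (Var num_cols) (Var col)) (Set num_cols (Add (Var num_cols) (Var same)))) s1 12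
     (\<lambda>s''. s'' col 0 = k \<and>
        frame {cols, num_cols, same, row, col} s (s''(col := (s'' col)(0 := Suc k))) \<and>
       map ((s''(col := (s'' col)(0 := Suc k))) cols) [0..<(s''(col := (s'' col)(0 := Suc k))) num_cols 0]
         = filter (\<lambda>j'. \<forall>i\<in>{l..<h}. (i, j') \<in> M \<longleftrightarrow> (i, j) \<in> M) [j..<Suc k])"
      by (rule runs_Seq_Put[where T = 7], simp, rule runs_Put, simp)
         (use k s1 m F in \<open>simp add: frame_upd\<close>)
  qed simp
qed (use assms n_le in \<open>auto simp: frame_upd frame_refl frame_def env_def\<close>)

text \<open>A positive \<open>out_end\<close> keeps the writes off cell 0, which holds the number of
  graphs; the exclusions on \<open>k\<close> keep the array being copied unchanged.\<close>

lemma write_list_runs: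
  assumes "1 \<le> s out_end 0" "s num_rows 0 = length us" "map (s k) [0..<length us] = us"
    "length us \<le> N" "k \<noteq> outp" "k \<noteq> out_end" "k \<noteq> idx"
  shows "runs (write_list k) s (24 * N + 21)
    (\<lambda>s'. frame {outp, out_end, idx} s s' \<and> s' outp 0 = s outp 0 \<and> 1 \<le> s' out_end 0 \<and>
      map (s' outp) [1..<s' out_end 0] = map (s outp) [1..<s out_end 0] @ length us # us)"
  unfolding write_list_def
proof (rule runs_Seq_Put[where T = "24 * N + 16"], simp, rule runs_Seq_Put[where T = "24 * N + 10"], simp,
    rule runs_mono[OF runs_For[where I = "\<lambda>i s'. frame {outp, out_end, idx} s s' \<and> s' outp 0 = s outp 0 \<and>
      1 \<le> s' out_end 0 \<and>
      map (s' outp) [1..<s' out_end 0] = map (s outp) [1..<s out_end 0] @ length us # take i us"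
      and T = 12 and l = 0 and h = "length us" and N = N and T' = "24 * N + 10"] order_refl])
  fix i s' assume i: "0 \<le> i" "i < length us" "s' idx 0 = i"
    and I: "frame {outp, out_end, idx} s s' \<and> s' outp 0 = s outp 0 \<and> 1 \<le> s' out_end 0 \<and>
      map (s' outp) [1..<s' out_end 0] = map (s outp) [1..<s out_end 0] @ length us # take i us"
  have u: "s' k i = us ! i"
    using I i assms by (simp add: frame_def) (metis add_0 nth_map_upt minus_nat.diff_0)
  show "runs (Seq (Put outp (Var out_end) (Get k (Var idx))) (Set out_end (Add (Var out_end) (Num 1)))) s' 12
     (\<lambda>s''. s'' idx 0 = i \<and> frame {outp, out_end, idx} s (s''(idx := (s'' idx)(0 := Suc i))) \<and>
       (s''(idx := (s'' idx)(0 := Suc i))) outp 0 = s outp 0 \<and> 1 \<le> (s''(idx := (s'' idx)(0 := Suc i))) out_end 0 \<and>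
       map ((s''(idx := (s'' idx)(0 := Suc i))) outp) [1..<(s''(idx := (s'' idx)(0 := Suc i))) out_end 0]
         = map (s outp) [1..<s out_end 0] @ length us # take (Suc i) us)"
    by (rule runs_Seq_Put[where T = 6], simp, rule runs_Put, simp)
       (use i I u in \<open>simp add: frame_upd take_Suc_conv_app_nth\<close>)
qed (use assms in \<open>auto simp: frame_upd frame_refl\<close>, auto simp: frame_def)

lemma clear_edges_runs:
  assumes "env s" "stores M s" "s num_rows 0 = length us" "length vs = length us"
    "map (s rows) [0..<length us] = us" "map (s cols) [0..<length vs] = vs"
    "set us \<subseteq> {..<m}" "set vs \<subseteq> {..<n}" "length us \<le> N"
  shows "runs clear_edges s (N * (23 * N + 22) + 10)
    (\<lambda>s'. frame {matrix, idx, idx2} s s' \<and> stores (M - set us \<times> set vs) s')"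
  unfolding clear_edges_def
proof (rule runs_mono[OF runs_For[where I = "\<lambda>x s'. frame {matrix, idx, idx2} s s' \<and>
      stores (M - set (take x us) \<times> set vs) s'"
      and T = "23 * N + 10" and l = 0 and h = "length us" and N = N and T' = "N * (23 * N + 22) + 10"] order_refl])
  fix x s1 assume x: "0 \<le> x" "x < length us" "s1 idx 0 = x"
    and I: "frame {matrix, idx, idx2} s s1 \<and> stores (M - set (take x us) \<times> set vs) s1"
  let ?M = "M - set (take x us) \<times> set vs"
  show "runs (For idx2 (Num 0) (Var num_rows)
      (Put matrix (Add (Get row_offset (Get rows (Var idx))) (Get col_offset (Get cols (Var idx2)))) (Num 0)))
      s1 (23 * N + 10) (\<lambda>s''. s'' idx 0 = x \<and>
        frame {matrix, idx, idx2} s (s''(idx := (s'' idx)(0 := Suc x))) \<and>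
        stores (M - set (take (Suc x) us) \<times> set vs) (s''(idx := (s'' idx)(0 := Suc x))))"
  proof (rule runs_mono[OF runs_For[where I = "\<lambda>y s'. s' idx 0 = x \<and> frame {matrix, idx, idx2} s s' \<and>
      stores (?M - {us ! x} \<times> set (take y vs)) s'"
      and T = 11 and l = 0 and h = "length us" and N = N and T' = "23 * N + 10"] order_refl])
    fix y s2 assume y: "0 \<le> y" "y < length us" "s2 idx2 0 = y"
      and J: "s2 idx 0 = x \<and> frame {matrix, idx, idx2} s s2 \<and> stores (?M - {us ! x} \<times> set (take y vs)) s2"
    have u: "s2 rows x = us ! x" "s2 cols y = vs ! y"
      using J x y assms by (simp_all add: frame_def) (metis add_0 nth_map_upt minus_nat.diff_0)+
    have b: "us ! x < m" "vs ! y < n"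
      using assms x y by (metis lessThan_iff nth_mem subsetD)+
    have o: "s2 row_offset (us ! x) = us ! x * rs" "s2 col_offset (vs ! y) = vs ! y * cs"
      using J assms b by (simp_all add: frame_def env_def)
    \<comment> \<open>By injectivity of the addresses, the cell being cleared belongs to no other
      entry.\<close>
    have eq: "i * rs + j * cs = us ! x * rs + vs ! y * cs \<longleftrightarrow> i = us ! x \<and> j = vs ! y" if "i < m" "j < n" for i j
      using inj_onD[OF inj, of "(i, j)" "(us ! x, vs ! y)"] that b by auto
    have st: "stores (?M - {us ! x} \<times> set (take (Suc y) vs)) (s2(matrix := (s2 matrix)(us ! x * rs + vs ! y * cs := 0)))"
      using J y assms eq by (auto simp: stores_def take_Suc_conv_app_nth)
    show "runs (Put matrix (Add (Get row_offset (Get rows (Var idx))) (Get col_offset (Get cols (Var idx2)))) (Num 0))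
      s2 11 (\<lambda>s''. s'' idx2 0 = y \<and> (s''(idx2 := (s'' idx2)(0 := Suc y))) idx 0 = x \<and>
        frame {matrix, idx, idx2} s (s''(idx2 := (s'' idx2)(0 := Suc y))) \<and>
        stores (?M - {us ! x} \<times> set (take (Suc y) vs)) (s''(idx2 := (s'' idx2)(0 := Suc y))))"
      by (rule runs_Put) (use J x y u o st in \<open>simp_all add: frame_upd stores_def\<close>)
  next
    fix s' assume J: "s' idx 0 = x \<and> frame {matrix, idx, idx2} s s' \<and>
      stores (?M - {us ! x} \<times> set (take (length us) vs)) s'"
    \<comment> \<open>As \<open>length vs = length us\<close>, the prefix is all of
      \<open>vs\<close>: the inner loop has cleared one full row of the product.\<close>
    have "?M - {us ! x} \<times> set (take (length us) vs) = M - set (take (Suc x) us) \<times> set vs"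
      using x assms(4) by (auto simp: take_Suc_conv_app_nth)
    with J show "s' idx 0 = x \<and> frame {matrix, idx, idx2} s (s'(idx := (s' idx)(0 := Suc x))) \<and>
        stores (M - set (take (Suc x) us) \<times> set vs) (s'(idx := (s' idx)(0 := Suc x)))"
      by (simp add: frame_upd stores_def)
  qed (use assms x I in \<open>auto simp: frame_upd stores_def\<close>, auto simp: frame_def)
qed (use assms in \<open>auto simp: frame_upd frame_refl stores_def\<close>, auto simp: frame_def)

end

section \<open>Correctness of the rounds\<close>

lemma pat_eq_iff: "(\<forall>i\<in>{l..<h}. (i, j') \<in> M \<longleftrightarrow> (i, j) \<in> M) \<longleftrightarrow> pat M l h j' = pat M l h j"
  unfolding pat_def by blast

context layout
begin

lemma emit_runs:
  assumes "env s" "stores M s" "written I s" "s num_rows 0 = length us" "length vs = length us"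
    "map (s rows) [0..<length us] = us" "map (s cols) [0..<length vs] = vs"
    "set us \<subseteq> {..<m}" "set vs \<subseteq> {..<n}" "length us \<le> N"
  shows "runs emit s (N * (23 * N + 70) + 63)
    (\<lambda>s'. frame {matrix, outp, out_end, idx, idx2} s s' \<and> stores (M - set us \<times> set vs) s' \<and>
          written (I @ [(us, vs)]) s')"
proof -
  \<comment> \<open>Stated for both orders of the two lists, so that it covers either branch of the
    test on \<open>swapped\<close>.\<close>
  have two: "runs (Seq (write_list k) (write_list k')) s (48 * N + 42)
    (\<lambda>s'. frame {outp, out_end, idx} s s' \<and> s' outp 0 = s outp 0 \<and> 1 \<le> s' out_end 0 \<and>
      map (s' outp) [1..<s' out_end 0] =
        map (s outp) [1..<s out_end 0] @ length as # as @ length bs # bs)"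
    if "map (s k) [0..<length as] = as" "map (s k') [0..<length bs] = bs" "length as = length us"
      "length bs = length us" "k \<in> {rows, cols}" "k' \<in> {rows, cols}" for k k' as bs
  proof (rule runs_Seq[where T = "24 * N + 21" and T' = "24 * N + 21"])
    show "runs (write_list k) s (24 * N + 21) (\<lambda>s'. frame {outp, out_end, idx} s s' \<and>
      s' outp 0 = s outp 0 \<and> 1 \<le> s' out_end 0 \<and>
      map (s' outp) [1..<s' out_end 0] = map (s outp) [1..<s out_end 0] @ length as # as)"
      using assms that by (intro write_list_runs) (auto simp: written_def)
  next
    fix s1 assume s1: "frame {outp, out_end, idx} s s1 \<and>
      s1 outp 0 = s outp 0 \<and> 1 \<le> s1 out_end 0 \<and>
      map (s1 outp) [1..<s1 out_end 0] = map (s outp) [1..<s out_end 0] @ length as # as"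
    then have s1k: "s1 k' = s k'" "s1 num_rows = s num_rows" using that(6) by (auto simp: frame_def)
    have "runs (write_list k') s1 (24 * N + 21) (\<lambda>s'. frame {outp, out_end, idx} s1 s' \<and>
      s' outp 0 = s1 outp 0 \<and> 1 \<le> s' out_end 0 \<and>
      map (s' outp) [1..<s' out_end 0] = map (s1 outp) [1..<s1 out_end 0] @ length bs # bs)"
      using assms that s1 s1k by (intro write_list_runs) auto
    then show "runs (write_list k') s1 (24 * N + 21) (\<lambda>s'. frame {outp, out_end, idx} s s' \<and>
      s' outp 0 = s outp 0 \<and> 1 \<le> s' out_end 0 \<and>
      map (s' outp) [1..<s' out_end 0] =
        map (s outp) [1..<s out_end 0] @ length as # as @ length bs # bs)"
      by (rule runs_mono) (use s1 in \<open>auto intro: frame_trans\<close>)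
  qed simp
  let ?W = "\<lambda>s'. frame {outp, out_end, idx} s s' \<and> s' outp 0 = length I \<and> 1 \<le> s' out_end 0 \<and>
      map (s' outp) [1..<s' out_end 0] =
       concat (map (\<lambda>(us, vs). length us # us @ length vs # vs)
         (if sw then map prod.swap (I @ [(us, vs)]) else I @ [(us, vs)]))"
  have W: "runs (Cond (Less (Num 0) (Var swapped))
       (Seq (write_list cols) (write_list rows)) (Seq (write_list rows) (write_list cols))) s (48 * N + 47) ?W"
  proof (rule runs_Cond[where T = "48 * N + 42"])
    assume "bval (Less (Num 0) (Var swapped)) s"
    then have sw using assms(1) by (auto simp: env_def)
    then show "runs (Seq (write_list cols) (write_list rows)) s (48 * N + 42) ?W"
      by (intro runs_mono[OF two[of cols vs rows us] order_refl]) (use assms(4-) assms(3)[unfolded written_def] in auto)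
  next
    assume "\<not> bval (Less (Num 0) (Var swapped)) s"
    then have "\<not> sw" using assms(1) by (auto simp: env_def)
    then show "runs (Seq (write_list rows) (write_list cols)) s (48 * N + 42) ?W"
      by (intro runs_mono[OF two[of rows us cols vs] order_refl]) (use assms(4-) assms(3)[unfolded written_def] in auto)
  qed simp
  show ?thesis unfolding emit_def
  proof (rule runs_Seq[OF W, where T' = "N * (23 * N + 22) + 16"], rule runs_Seq_Put[where T = "N * (23 * N + 22) + 10"])
    fix s1 assume s1: "?W s1"
    let ?s = "s1(outp := (s1 outp)(aval (Num 0) s1 := aval (Add (Var outp) (Num 1)) s1))"
    have F: "frame {outp, out_end, idx} s ?s" using s1 by (simp add: frame_upd)
    have "map (?s outp) [1..<?s out_end 0] = map (s1 outp) [1..<s1 out_end 0]"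
      by simp
    then have wr: "written (I @ [(us, vs)]) ?s" using s1 unfolding written_def by simp
    have "env ?s" "stores M ?s" using env_frame[OF F] stores_frame[OF F] assms by simp_all
    moreover have "?s num_rows = s num_rows" "?s rows = s rows" "?s cols = s cols" using F by (simp_all add: frame_def)
    ultimately have "runs clear_edges ?s (N * (23 * N + 22) + 10)
       (\<lambda>s'. frame {matrix, idx, idx2} ?s s' \<and> stores (M - set us \<times> set vs) s')"
      using assms by (intro clear_edges_runs) auto
    then show "runs clear_edges ?s (N * (23 * N + 22) + 10)
      (\<lambda>s'. frame {matrix, outp, out_end, idx, idx2} s s' \<and> stores (M - set us \<times> set vs) s' \<and>
          written (I @ [(us, vs)]) s')"
    proof (rule runs_mono[OF _ order_refl])
      fix s' assume s': "frame {matrix, idx, idx2} ?s s' \<and> stores (M - set us \<times> set vs) s'"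
      then have "written (I @ [(us, vs)]) s'" using wr written_frame[of "{matrix, idx, idx2}" ?s s'] by simp
      moreover have "frame {matrix, outp, out_end, idx, idx2} s s'"
        by (rule frame_trans[OF F]) (use s' in auto)
      ultimately show "frame {matrix, outp, out_end, idx, idx2} s s' \<and> stores (M - set us \<times> set vs) s' \<and>
          written (I @ [(us, vs)]) s'" using s' by blast
    qed
  qed (auto simp: algebra_simps)
qed

text \<open>What the treatment of one pivot may change. The variables \<open>pivot\<close>,
  \<open>lo\<close> and \<open>hi\<close> are left out because only the surrounding loops change
  them.\<close>

definition scratch :: "nat set" where
  "scratch = {matrix, outp, out_end, idx, idx2, rows, num_rows, row, cols, num_cols, same, col}"

text \<open>The sum of \<open>30 * N + 13\<close> for the rows,
  \<open>N * (52 * N + 37) + 13\<close> for the columns and \<open>N * (23 * N + 70) + 75\<close>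
  for the conditional output.\<close>

definition pivot_time :: nat where
  "pivot_time = N * (75 * N + 137) + 101"

lemma process_pivot_runs:
  assumes "env s" "stores M s" "written I s" "s lo 0 = l" "s hi 0 = h" "s pivot 0 = j"
    "l \<le> h" "h \<le> m" "j < n"
  shows "runs process_pivot s pivot_time (\<lambda>s'. frame scratch s s' \<and>
    (\<exists>M' I'. stores M' s' \<and> written I' s' \<and> pivot_step n l h j M I M' I'))"
proof -
  define us where "us = filter (\<lambda>i. (i, j) \<in> M) [l..<h]"
  define ws where "ws = filter (\<lambda>j'. pat M l h j' = pat M l h j) [j..<n]"
  have us: "set us = pat M l h j" "distinct us" "set us \<subseteq> {..<m}"
    using assms by (auto simp: us_def pat_def)
  have "length us \<le> length [l..<h]" unfolding us_def by (rule length_filter_le)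
  then have us_N: "length us \<le> N" using assms m_le by simp
  have ws: "set ws = {j' \<in> {j..<n}. pat M l h j' = pat M l h j}" "distinct ws"
    by (auto simp: ws_def)
  \<comment> \<open>The pivot heads the list of its class, so any nonempty prefix of that list
    retains it.\<close>
  have ws_hd: "\<exists>ws'. ws = j # ws'" using assms(9) by (simp add: ws_def upt_conv_Cons)
  have R: "runs collect_rows s (30 * N + 13)
    (\<lambda>s'. frame {rows, num_rows, row} s s' \<and> map (s' rows) [0..<s' num_rows 0] = us)"
    unfolding us_def by (rule collect_rows_runs[OF assms(1,2,4-9)])
  show ?thesis unfolding process_pivot_def
  proof (rule runs_Seq[OF R, where T' = "N * (75 * N + 107) + 88"])
    fix s1 assume s1: "frame {rows, num_rows, row} s s1 \<and> map (s1 rows) [0..<s1 num_rows 0] = us"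
    then have F1: "frame {rows, num_rows, row} s s1" by simp
    have s1v: "s1 lo 0 = l" "s1 hi 0 = h" "s1 pivot 0 = j" using F1 assms by (simp_all add: frame_def)
    have e1: "env s1" "stores M s1" using env_frame[OF F1] stores_frame[OF F1] assms by simp_all
    have C: "runs collect_cols s1 (N * (52 * N + 37) + 13)
      (\<lambda>s'. frame {cols, num_cols, same, row, col} s1 s' \<and> map (s' cols) [0..<s' num_cols 0] = ws)"
      using collect_cols_runs[OF e1 s1v assms(7-9)] unfolding ws_def pat_eq_iff .
    show "runs (Seq collect_cols (Cond (Conj (Less (Num 0) (Var num_rows)) (Neg (Less (Var num_cols) (Var num_rows)))) emit Skip))
      s1 (N * (75 * N + 107) + 88) (\<lambda>s'. frame scratch s s' \<and>
        (\<exists>M' I'. stores M' s' \<and> written I' s' \<and> pivot_step n l h j M I M' I'))"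
    proof (rule runs_Seq[OF C, where T' = "N * (23 * N + 70) + 75"])
      fix s2 assume s2: "frame {cols, num_cols, same, row, col} s1 s2 \<and> map (s2 cols) [0..<s2 num_cols 0] = ws"
      have F2: "frame {rows, num_rows, cols, num_cols, same, row, col} s s2"
        by (rule frame_trans[OF F1]) (use s2 in auto)
      then have sF: "frame scratch s s2" unfolding scratch_def by (rule frame_trans[OF _ frame_refl[of "{}"]]) auto
      have e2: "env s2" "stores M s2" "written I s2"
        using env_frame[OF F2] stores_frame[OF F2] written_frame[OF F2] assms by simp_all
      have r: "map (s2 rows) [0..<s2 num_rows 0] = us" using s1 s2 by (simp add: frame_def)
      have nr: "s2 num_rows 0 = length us" by (subst r[symmetric]) simp
      have nc: "s2 num_cols 0 = length ws" using s2 by (metis length_map length_upt minus_nat.diff_0)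
      show "runs (Cond (Conj (Less (Num 0) (Var num_rows)) (Neg (Less (Var num_cols) (Var num_rows)))) emit Skip)
        s2 (N * (23 * N + 70) + 75) (\<lambda>s'. frame scratch s s' \<and>
        (\<exists>M' I'. stores M' s' \<and> written I' s' \<and> pivot_step n l h j M I M' I'))"
      proof (rule runs_Cond[where T = "N * (23 * N + 70) + 63"])
        assume "bval (Conj (Less (Num 0) (Var num_rows)) (Neg (Less (Var num_cols) (Var num_rows)))) s2"
        then have le: "us \<noteq> []" "length us \<le> length ws" using nr nc by auto
        define vs where "vs = take (length us) ws"
        have vs: "length vs = length us" "distinct vs" "set vs \<subseteq> set ws"
          using le ws(2) by (auto simp: vs_def dest: in_set_takeD)
        have jv: "j \<in> set vs" using ws_hd le by (cases us) (auto simp: vs_def)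
        have "map (s2 cols) [0..<length vs] = take (length vs) (map (s2 cols) [0..<s2 num_cols 0])"
          using le nc vs(1) by (simp add: take_map)
        then have c: "map (s2 cols) [0..<length vs] = vs" using s2 vs(1) by (simp add: vs_def)
        have vn: "set vs \<subseteq> {..<n}" using vs ws by auto
        have "pivot_step n l h j M I (M - set us \<times> set vs) (I @ [(us, vs)])"
          unfolding pivot_step_def using us vs ws le jv by auto
        moreover have "runs emit s2 (N * (23 * N + 70) + 63)
          (\<lambda>s'. frame {matrix, outp, out_end, idx, idx2} s2 s' \<and> stores (M - set us \<times> set vs) s' \<and>
          written (I @ [(us, vs)]) s')"
          by (rule emit_runs[OF e2 nr vs(1) r[unfolded nr] c us(3) vn us_N])
        ultimately show "runs emit s2 (N * (23 * N + 70) + 63) (\<lambda>s'. frame scratch s s' \<and>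
          (\<exists>M' I'. stores M' s' \<and> written I' s' \<and> pivot_step n l h j M I M' I'))"
          by (elim runs_mono[OF _ order_refl]) (auto intro!: frame_trans[OF F2] simp: scratch_def)
      next
        assume "\<not> bval (Conj (Less (Num 0) (Var num_rows)) (Neg (Less (Var num_cols) (Var num_rows)))) s2"
        then have "us = [] \<or> length ws < length us" using nr nc by auto
        then have "pivot_step n l h j M I M I"
          unfolding pivot_step_def using us ws distinct_card[of us] distinct_card[of ws] by auto
        then show "runs Skip s2 (N * (23 * N + 70) + 63) (\<lambda>s'. frame scratch s s' \<and>
          (\<exists>M' I'. stores M' s' \<and> written I' s' \<and> pivot_step n l h j M I M' I'))"
          using e2 sF by (intro runs_Skip) auto
      qed simp
    qed (simp add: algebra_simps)
  qed (simp add: algebra_simps pivot_time_def)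
qed

definition blocks_time :: nat where
  "blocks_time = N * (N * (pivot_time + 12) + 39) + 9"

lemma process_blocks_runs:
  assumes "env s" "stores M1 s" "written I1 s" "s block_size 0 = k" "1 \<le> k"
    "biclique_partition (M0 - M1) I1" "M1 \<subseteq> M0" "c = (m + k - 1) div k"
  shows "runs process_blocks s blocks_time (\<lambda>s'. frame (scratch \<union> {pivot, lo, hi}) s s' \<and>
    (\<exists>M I. stores M s' \<and> written I s' \<and> blocks_inv n k m M0 M1 (weight I1) c M I))"
proof -
  have M1: "M1 \<subseteq> {..<m} \<times> {..<n}" using assms(2) by (simp add: stores_def)
  then have fin1: "finite M1" by (meson finite_SigmaI finite_lessThan finite_subset)
  \<comment> \<open>\<open>c\<close> is \<open>m / k\<close> rounded up, so block \<open>t\<close>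
    exists precisely when its first row \<open>t * k\<close> lies below \<open>m\<close>.\<close>
  have c: "t < c \<longleftrightarrow> t * k < m" for t
  proof -
    have "t < c \<longleftrightarrow> Suc t \<le> (m + k - 1) div k" using assms(8) by auto
    also have "\<dots> \<longleftrightarrow> Suc t * k \<le> m + k - 1" using assms(5) by (intro less_eq_div_iff_mult_less_eq) auto
    also have "\<dots> \<longleftrightarrow> t * k < m" using assms(5) by auto
    finally show ?thesis .
  qed
  have "c \<le> m"
  proof (rule ccontr)
    assume "\<not> c \<le> m"
    then have "m * k < m" using c[of m] by simp
    then show False using assms(5) by (cases k) auto
  qed
  then have cN: "c \<le> N" using m_le by simp
  define J where "J = (\<lambda>t s'. s' lo 0 = t * k \<and> frame (scratch \<union> {pivot, lo, hi}) s s' \<and>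
    (\<exists>M I. stores M s' \<and> written I s' \<and> blocks_inv n k m M0 M1 (weight I1) t M I))"
  have envJ: "env s'" "s' block_size 0 = k" if "J t s'" for t s'
  proof -
    have F: "frame (scratch \<union> {pivot, lo, hi}) s s'" using that by (simp add: J_def)
    show "env s'" using env_frame[OF F] assms(1) by (simp add: scratch_def)
    show "s' block_size 0 = k" using F assms(4) by (simp add: frame_def scratch_def)
  qed
  show ?thesis unfolding process_blocks_def
  proof (rule runs_Seq_Put[where T = "blocks_time - 3"], simp add: blocks_time_def,
      rule runs_mono[OF runs_While[where I = J and c = c and T = "N * (pivot_time + 12) + 33" and T' = "blocks_time - 3"] order_refl])
    show "J 0 (s(lo := (s lo)(aval (Num 0) s := aval (Num 0) s)))"
    proof -
      let ?s = "s(lo := (s lo)(aval (Num 0) s := aval (Num 0) s))"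
      have "stores M1 ?s" "written I1 ?s" using assms(2,3) by (simp_all add: stores_def written_def)
      moreover have "blocks_inv n k m M0 M1 (weight I1) 0 M1 I1" using assms(6) by (simp add: blocks_inv_def)
      moreover have "frame (scratch \<union> {pivot, lo, hi}) s ?s" by (simp add: frame_upd frame_refl)
      ultimately show ?thesis unfolding J_def by auto
    qed
  next
    fix t s' assume t: "t < c" and Jt: "J t s'"
    then have tk: "t * k < m" using c by simp
    from Jt obtain M I where MI: "stores M s'" "written I s'" "blocks_inv n k m M0 M1 (weight I1) t M I"
      and lo: "s' lo 0 = t * k" and fr: "frame (scratch \<union> {pivot, lo, hi}) s s'"
      by (auto simp: J_def)
    define h where "h = min (Suc t * k) m"
    have MM1: "M \<subseteq> M1" "biclique_partition (M0 - M) I" using MI(3) by (auto simp: blocks_inv_def)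
    have finM: "finite M" "M \<subseteq> M0" using MM1 fin1 assms(7) by (auto intro: finite_subset)
    note e = envJ[OF Jt]
    have H: "runs (Cond (Less (Add (Var lo) (Var block_size)) (Var height))
            (Set hi (Add (Var lo) (Var block_size))) (Set hi (Var height))) s' 16
        (\<lambda>s1. frame {hi} s' s1 \<and> s1 hi 0 = h)"
      by (rule runs_Cond[where T = 7]; (rule runs_Put)?)
        (use e lo in \<open>auto simp: frame_upd frame_refl h_def env_def\<close>)
    have "runs (Seq (Cond (Less (Add (Var lo) (Var block_size)) (Var height))
            (Set hi (Add (Var lo) (Var block_size))) (Set hi (Var height)))
     (Seq (For pivot (Num 0) (Var width) process_pivot)
          (Set lo (Add (Var lo) (Var block_size))))) s' (N * (pivot_time + 12) + 33) (J (Suc t))"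
    proof (rule runs_Seq[OF H, where T' = "N * (pivot_time + 12) + 17"])
      fix s1 assume s1: "frame {hi} s' s1 \<and> s1 hi 0 = h"
      then have F1: "frame {hi} s' s1" by simp
      have e1: "env s1" "stores M s1" "written I s1"
        using env_frame[OF F1] stores_frame[OF F1] written_frame[OF F1] e MI by simp_all
      \<comment> \<open>\<open>M\<close> and \<open>weight I\<close> at the start of the block are
        the reference values here, while \<open>M0\<close> stays the full edge set of the
        graph.\<close>
      define K where "K = (\<lambda>j s2. frame (scratch \<union> {pivot}) s1 s2 \<and>
        (\<exists>M' I'. stores M' s2 \<and> written I' s2 \<and> block_inv n (t * k) h M0 M (weight I) j M' I'))"
      have envK: "env s2" "s2 lo 0 = t * k" "s2 hi 0 = h" if "K j s2" for j s2
      proof -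
        have F: "frame (scratch \<union> {pivot}) s1 s2" using that by (simp add: K_def)
        show "env s2" using env_frame[OF F] e1 by (simp add: scratch_def)
        show "s2 lo 0 = t * k" "s2 hi 0 = h" using F s1 lo by (simp_all add: frame_def scratch_def)
      qed
      have "runs (For pivot (Num 0) (Var width) process_pivot) s1 (N * (pivot_time + 12) + 10) (K n)"
      proof (rule runs_For[where I = K and l = 0 and N = N and T = pivot_time])
        show "K 0 (s1(pivot := (s1 pivot)(0 := 0)))"
          using e1(2,3) block_inv_init[OF MM1(2), of n "t * k" h]
          by (simp add: K_def frame_upd frame_refl stores_def written_def) blast
        show "aval (Var width) s2 = n" if "K i s2" for i s2 using envK[OF that] by (simp add: env_def)
      next
        fix j s2 assume j: "0 \<le> j" "j < n" "s2 pivot 0 = j" and Kj: "K j s2"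
        then obtain M' I' where MI': "stores M' s2" "written I' s2" "block_inv n (t * k) h M0 M (weight I) j M' I'"
          and F: "frame (scratch \<union> {pivot}) s1 s2"
          by (auto simp: K_def)
        have "runs process_pivot s2 pivot_time (\<lambda>s'. frame scratch s2 s' \<and>
          (\<exists>M'' I''. stores M'' s' \<and> written I'' s' \<and> pivot_step n (t * k) h j M' I' M'' I''))"
          by (rule process_pivot_runs) (use envK[OF Kj] MI' j tk in \<open>auto simp: h_def\<close>)
        then show "runs process_pivot s2 pivot_time (\<lambda>s''. s'' pivot 0 = j \<and> K (Suc j) (s''(pivot := (s'' pivot)(0 := Suc j))))"
        proof (rule runs_mono[OF _ order_refl])
          fix s3 assume s3: "frame scratch s2 s3 \<and>
            (\<exists>M'' I''. stores M'' s3 \<and> written I'' s3 \<and> pivot_step n (t * k) h j M' I' M'' I'')"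
          then obtain M'' I'' where MI'': "stores M'' s3" "written I'' s3" "pivot_step n (t * k) h j M' I' M'' I''"
            by blast
          have "block_inv n (t * k) h M0 M (weight I) (Suc j) M'' I''"
            by (rule block_inv_step[OF MI'(3) MI''(3) j(2) finM])
          moreover have "frame (scratch \<union> {pivot}) s1 s3"
            by (rule frame_trans[OF F]) (use s3 in auto)
          moreover have "s3 pivot 0 = j" using s3 j by (simp add: frame_def scratch_def)
          ultimately show "s3 pivot 0 = j \<and> K (Suc j) (s3(pivot := (s3 pivot)(0 := Suc j)))"
            using MI''(1,2) by (simp add: K_def frame_upd stores_def written_def) blast
        qed
      qed (use n_le in auto)
      then show "runs (Seq (For pivot (Num 0) (Var width) process_pivot)
          (Set lo (Add (Var lo) (Var block_size)))) s1 (N * (pivot_time + 12) + 17) (J (Suc t))"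
      proof (rule runs_Seq[where T' = 7])
        fix s2 assume K: "K n s2"
        then obtain M' I' where MI': "stores M' s2" "written I' s2" "block_inv n (t * k) h M0 M (weight I) n M' I'"
          and F: "frame (scratch \<union> {pivot}) s1 s2"
          by (auto simp: K_def)
        have F2: "frame (scratch \<union> {pivot, lo, hi}) s s2"
          by (rule frame_trans[OF fr frame_trans[OF F1 F order_refl]]) auto
        then have "s2 block_size 0 = k" using assms(4) by (simp add: frame_def scratch_def)
        moreover have "blocks_inv n k m M0 M1 (weight I1) (Suc t) M' I'"
          by (rule blocks_inv_step[OF MI(3) MI'(3) h_def tk M1])
        ultimately show "runs (Set lo (Add (Var lo) (Var block_size))) s2 7 (J (Suc t))"
          using envK[OF K] MI' F2
          by (intro runs_Put) (simp_all add: J_def frame_upd stores_def written_def, blast)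
      qed simp
    qed simp
    then show "bval (Less (Var lo) (Var height)) s' \<and>
      runs (Seq (Cond (Less (Add (Var lo) (Var block_size)) (Var height))
            (Set hi (Add (Var lo) (Var block_size))) (Set hi (Var height)))
     (Seq (For pivot (Num 0) (Var width) process_pivot)
          (Set lo (Add (Var lo) (Var block_size))))) s' (N * (pivot_time + 12) + 33) (J (Suc t))"
      using e lo tk by (simp add: env_def)
  next
    fix s' assume "J c s'"
    then show "\<not> bval (Less (Var lo) (Var height)) s'"
      using envJ[of c s'] c[of c] by (simp add: J_def env_def)
  next
    have "c * (N * (pivot_time + 12) + 39) \<le> N * (N * (pivot_time + 12) + 39)"
      using cN by (rule mult_right_mono) simp
    then show "c * (bcost (Less (Var lo) (Var height)) + (N * (pivot_time + 12) + 33) + 1) +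
      bcost (Less (Var lo) (Var height)) + 1 \<le> blocks_time - 3"
      by (simp add: blocks_time_def add.commute)
  qed (auto simp: J_def)
qed

text \<open>The first round costs at most \<open>2 * n\<close> per block and leaves at most
  \<open>2 ^ k * (k * (k - 1))\<close> edges per block. The second adds at most 2 for each of these;
  its own bound by columns would be useless, as it has \<open>m\<close> blocks.\<close>

lemma two_rounds_runs:
  assumes "env s" "stores M0 s" "written [] s" "s block_size 0 = k" "1 \<le> k"
  shows "runs (Seq process_blocks (Seq (Set block_size (Num 1)) process_blocks)) s (2 * blocks_time + 3)
    (\<lambda>s'. \<exists>I. written I s' \<and> biclique_partition M0 I \<and>
       weight I \<le> (m + k - 1) div k * (2 * n + 2 * (2 ^ k * (k * (k - 1)))))"
proof -
  have card_le: "card M \<le> (m + k - 1) div k * (2 ^ k * (k * (k - 1)))"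
    if "blocks_inv n k m M0 M1 w ((m + k - 1) div k) M I" "M1 \<subseteq> M0" "1 \<le> k" for k M1 w M I
  proof -
    \<comment> \<open>Rounding up covers all rows, so the clause of \<open>blocks_inv\<close> on
      finished rows counts every remaining edge.\<close>
    have "m \<le> (m + k - 1) div k * k"
    proof (rule ccontr)
      assume "\<not> m \<le> (m + k - 1) div k * k"
      then have "Suc ((m + k - 1) div k) * k \<le> m + k - 1" by auto
      then have "Suc ((m + k - 1) div k) \<le> (m + k - 1) div k"
        using that(3) by (subst less_eq_div_iff_mult_less_eq) auto
      then show False by simp
    qed
    moreover have "M \<subseteq> {..<m} \<times> UNIV"
      using that(1,2) assms(2) by (auto simp: blocks_inv_def stores_def)
    ultimately have "M \<inter> {..<min ((m + k - 1) div k * k) m} \<times> UNIV = M" by (metis Int_absorb2 min.absorb2)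
    then show ?thesis using that(1) by (simp add: blocks_inv_def)
  qed
  let ?c = "(m + k - 1) div k"
  have A: "runs process_blocks s blocks_time (\<lambda>s'. frame (scratch \<union> {pivot, lo, hi}) s s' \<and>
    (\<exists>M I. stores M s' \<and> written I s' \<and> blocks_inv n k m M0 M0 (weight []) ?c M I))"
    by (rule process_blocks_runs[OF assms]) (auto simp: biclique_partition_Nil)
  show ?thesis
  proof (rule runs_Seq[OF A, where T' = "blocks_time + 3"], rule runs_Seq_Put[where T = blocks_time])
    fix s1 assume "frame (scratch \<union> {pivot, lo, hi}) s s1 \<and>
      (\<exists>M I. stores M s1 \<and> written I s1 \<and> blocks_inv n k m M0 M0 (weight []) ?c M I)"
    then obtain M I where F: "frame (scratch \<union> {pivot, lo, hi}) s s1" and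
      MI: "stores M s1" "written I s1" "blocks_inv n k m M0 M0 (weight []) ?c M I" by blast
    let ?s = "s1(block_size := (s1 block_size)(aval (Num 0) s1 := aval (Num 1) s1))"
    have e: "env ?s" "stores M ?s" "written I ?s" "?s block_size 0 = 1"
      using env_frame[OF F] assms(1) MI by (simp_all add: scratch_def env_def stores_def written_def)
    have M: "biclique_partition (M0 - M) I" "M \<subseteq> M0" using MI(3) by (auto simp: blocks_inv_def)
    have wI: "weight I + 2 * card M \<le> ?c * (2 * n + 2 * (2 ^ k * (k * (k - 1))))"
    proof -
      have "weight I \<le> ?c * (2 * n)" using MI(3) by (simp add: blocks_inv_def weight_def)
      then show ?thesis using card_le[OF MI(3) subset_refl assms(5)]
        unfolding distrib_left mult.left_commute[of ?c 2] by linarith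
    qed
    have "runs process_blocks ?s blocks_time (\<lambda>s'. frame (scratch \<union> {pivot, lo, hi}) ?s s' \<and>
      (\<exists>M' I'. stores M' s' \<and> written I' s' \<and> blocks_inv n 1 m M0 M (weight I) ((m + 1 - 1) div 1) M' I'))"
      by (rule process_blocks_runs[OF e order_refl M refl])
    then show "runs process_blocks ?s blocks_time (\<lambda>s'. \<exists>I. written I s' \<and> biclique_partition M0 I \<and>
       weight I \<le> (m + k - 1) div k * (2 * n + 2 * (2 ^ k * (k * (k - 1)))))"
    proof (rule runs_mono[OF _ order_refl])
      fix s' assume "frame (scratch \<union> {pivot, lo, hi}) ?s s' \<and>
        (\<exists>M' I'. stores M' s' \<and> written I' s' \<and> blocks_inv n 1 m M0 M (weight I) ((m + 1 - 1) div 1) M' I')"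
      then obtain M' I' where MI': "written I' s'" "stores M' s'"
        "blocks_inv n 1 m M0 M (weight I) ((m + 1 - 1) div 1) M' I'" by blast
      have "finite M'" using MI'(2) by (auto simp: stores_def intro: finite_subset)
      \<comment> \<open>For blocks of one row the factor \<open>k - 1\<close> vanishes, so no edge
        survives the second round.\<close>
      moreover have "card M' = 0" using card_le[OF MI'(3) M(2)] by simp
      ultimately have "M' = {}" by simp
      then have "biclique_partition M0 I'" "weight I' \<le> weight I + 2 * card M"
        using MI'(3) by (auto simp: blocks_inv_def)
      then show "\<exists>I. written I s' \<and> biclique_partition M0 I \<and>
        weight I \<le> (m + k - 1) div k * (2 * n + 2 * (2 ^ k * (k * (k - 1))))"
        using MI'(1) wI by (meson le_trans)
    qed
  qed simp_all
qed

end

section \<open>Setting up the layout and the block size\<close>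

lemma fill_offsets_runs:
  assumes "s k 0 = 0" "s d 0 = w" "s z 0 = c" "c \<le> N" "k \<noteq> row" "d \<noteq> row" "z \<noteq> row" "k \<noteq> d" "k \<noteq> z"
  shows "runs (fill_offsets k d z) s (23 * N + 10)
    (\<lambda>s'. frame {k, row} s s' \<and> (\<forall>i\<le>c. s' k i = i * w))"
  unfolding fill_offsets_def
proof (rule runs_For[where I = "\<lambda>i s'. frame {k, row} s s' \<and> (\<forall>i'\<le>i. s' k i' = i' * w)"
    and T = 11 and l = 0 and h = c and N = N])
  fix i s' assume i: "s' row 0 = i" and I: "frame {k, row} s s' \<and> (\<forall>i'\<le>i. s' k i' = i' * w)"
  then have "s' d 0 = w" using assms by (simp add: frame_def)
  then show "runs (Put k (Add (Var row) (Num 1)) (Add (Get k (Var row)) (Var d))) s' 11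
    (\<lambda>s''. s'' row 0 = i \<and> frame {k, row} s (s''(row := (s'' row)(0 := Suc i))) \<and>
      (\<forall>i'\<le>Suc i. (s''(row := (s'' row)(0 := Suc i))) k i' = i' * w))"
    by (intro runs_Put) (use i I assms in \<open>auto simp: frame_upd le_Suc_eq\<close>)
qed (use assms in \<open>auto simp: frame_upd frame_refl frame_def\<close>)

text \<open>The loop stops at the least power of 4 above \<open>n\<close>. That it needs at most
  \<open>n\<close> iterations is crude, but enough for polynomial time.\<close>

lemma choose_block_size_runs:
  assumes "s width 0 = n" "n \<le> N"
  shows "runs choose_block_size s (26 * N + 13)
    (\<lambda>s'. frame {block_size, power4} s s' \<and>
          (\<exists>k\<ge>1. s' block_size 0 = k \<and> n < 4 ^ k \<and> 4 ^ (k - 1) \<le> max 1 n))"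
proof -
  have gt: "i < 4 ^ Suc i" for i :: nat by (induction i) auto
  define q where "q = (LEAST q. n < 4 ^ Suc q)"
  have q: "n < 4 ^ Suc q" "q \<le> n" unfolding q_def using gt[of n] by (rule LeastI, rule Least_le)
  have min: "\<not> n < 4 ^ Suc i" if "i < q" for i using that not_less_Least unfolding q_def by blast
  define J where "J = (\<lambda>i s'. frame {block_size, power4} s s' \<and> s' block_size 0 = Suc i \<and> s' power4 0 = 4 ^ Suc i)"
  have w: "s' width 0 = n" if "J i s'" for i s' using that assms(1) by (simp add: J_def frame_def)
  show ?thesis unfolding choose_block_size_def
  proof (rule runs_Seq_Put[where T = "26 * N + 10"], simp, rule runs_Seq_Put[where T = "26 * N + 7"], simp,
      rule runs_mono[OF runs_While[where I = J and c = q and T = 19 and T' = "26 * N + 7"] order_refl])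
    fix i s' assume i: "i < q" and J: "J i s'"
    have "runs (Seq (Set power4 (Add (Add (Var power4) (Var power4)) (Add (Var power4) (Var power4))))
            (Set block_size (Add (Var block_size) (Num 1)))) s' 19 (J (Suc i))"
      by (rule runs_Seq_Put[where T = 6], simp, rule runs_Put, simp) (use J in \<open>simp add: J_def frame_upd\<close>)
    then show "bval (Neg (Less (Var width) (Var power4))) s' \<and>
      runs (Seq (Set power4 (Add (Add (Var power4) (Var power4)) (Add (Var power4) (Var power4))))
            (Set block_size (Add (Var block_size) (Num 1)))) s' 19 (J (Suc i))"
      using J w[OF J] min[OF i] by (simp add: J_def)
  next
    fix s' assume J: "J q s'"
    then show "\<not> bval (Neg (Less (Var width) (Var power4))) s'" using w[OF J] q by (simp add: J_def)
    \<comment> \<open>Minimality of \<open>q\<close> gives this when \<open>q\<close> is positive.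
      For \<open>q = 0\<close> the left side is 1, and \<open>n\<close> may be 0, hence the
      maximum.\<close>
    have "4 ^ q \<le> max 1 n"
    proof (cases q)
      case (Suc r)
      then show ?thesis using min[of r] by auto
    qed simp
    then show "frame {block_size, power4} s s' \<and>
          (\<exists>k\<ge>1. s' block_size 0 = k \<and> n < 4 ^ k \<and> 4 ^ (k - 1) \<le> max 1 n)"
      using J q by (simp add: J_def)
  qed (use assms q in \<open>auto simp: J_def frame_upd frame_refl\<close>)
qed

lemma choose_layout_runs:
  assumes "s sizes 0 = a" "s sizes 1 = b"
  shows "runs choose_layout s 24
    (\<lambda>s'. frame {height, width, swapped, row_step, col_step} s s' \<and>
       s' height 0 = min a b \<and> s' width 0 = max a b \<and> s' swapped 0 = of_bool (b < a) \<and>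
       s' row_step 0 = (if b < a then 1 else b) \<and> s' col_step 0 = (if b < a then b else 1))"
  unfolding choose_layout_def
proof (rule runs_Cond[where T = 18])
  assume "bval (Less (Get sizes (Num 1)) (Get sizes (Num 0))) s"
  then have lt: "b < a" using assms by simp
  show "runs (Seq (Set swapped (Num 1))
     (Seq (Set height (Get sizes (Num 1))) (Seq (Set width (Get sizes (Num 0)))
     (Seq (Set row_step (Num 1)) (Set col_step (Get sizes (Num 1))))))) s 18
     (\<lambda>s'. frame {height, width, swapped, row_step, col_step} s s' \<and>
       s' height 0 = min a b \<and> s' width 0 = max a b \<and> s' swapped 0 = of_bool (b < a) \<and>
       s' row_step 0 = (if b < a then 1 else b) \<and> s' col_step 0 = (if b < a then b else 1))"
    by (rule runs_Seq_Put[where T = 15], simp, rule runs_Seq_Put[where T = 11], simp,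
        rule runs_Seq_Put[where T = 7], simp, rule runs_Seq_Put[where T = 4], simp, rule runs_Put, simp)
       (use assms lt in \<open>simp add: frame_upd frame_refl\<close>)
next
  assume "\<not> bval (Less (Get sizes (Num 1)) (Get sizes (Num 0))) s"
  then have ge: "\<not> b < a" using assms by simp
  show "runs (Seq (Set swapped (Num 0))
     (Seq (Set height (Get sizes (Num 0))) (Seq (Set width (Get sizes (Num 1)))
     (Seq (Set row_step (Get sizes (Num 1))) (Set col_step (Num 1)))))) s 18
     (\<lambda>s'. frame {height, width, swapped, row_step, col_step} s s' \<and>
       s' height 0 = min a b \<and> s' width 0 = max a b \<and> s' swapped 0 = of_bool (b < a) \<and>
       s' row_step 0 = (if b < a then 1 else b) \<and> s' col_step 0 = (if b < a then b else 1))"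
    by (rule runs_Seq_Put[where T = 15], simp, rule runs_Seq_Put[where T = 11], simp,
        rule runs_Seq_Put[where T = 7], simp, rule runs_Seq_Put[where T = 3], simp, rule runs_Put, simp)
       (use assms ge in \<open>simp add: frame_upd frame_refl\<close>)
qed simp

section \<open>The numerical estimate of the weight\<close>

lemma Suc_mult_self_le_power2: "Suc j * j \<le> 4 * 2 ^ j"
proof (induction j)
  case (Suc j)
  show ?case
  proof (cases "j < 2")
    case True
    then have "j = 0 \<or> j = 1" by auto
    then show ?thesis by auto
  next
    case False
    \<comment> \<open>From \<open>j = 2\<close> on, \<open>j + 2\<close> is at most
      \<open>2 * j\<close>, so the left side at most doubles; the two smaller cases are checked
      directly.\<close>
    then have "Suc (Suc j) * Suc j \<le> (2 * j) * Suc j" by (intro mult_right_mono) auto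
    also have "\<dots> \<le> 2 * (4 * 2 ^ j)" using Suc by (simp add: mult.commute)
    finally show ?thesis by simp
  qed
qed simp

text \<open>The 18 is 2 for the columns plus twice the 8 for leftover edges. The 3 comes from
  \<open>ln (m + n) \<le> 3 * k\<close>, because \<open>m + n\<close> is at most
  \<open>2 * 4 ^ k\<close> and \<open>ln 2 < 1\<close>. The term \<open>\<bar>K\<bar>\<close> pays
  for rounding up the number of blocks; the absolute value keeps the constant positive for every
  \<open>K\<close>.\<close>

lemma total_weight_bound:
  fixes m n k :: nat and K :: real
  assumes "1 \<le> m" "m \<le> n" "1 \<le> k" "n < 4 ^ k" "4 ^ (k - 1) \<le> n"
    and lnK: "ln (real (m + n)) \<le> K * real m"
  shows "real ((m + k - 1) div k * (2 * n + 2 * (2 ^ k * (k * (k - 1)))))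
    \<le> 18 * (3 + \<bar>K\<bar>) * (real (m * n) / ln (real (m + n)))"
proof -
  define L where "L = ln (real (m + n))"
  have L: "L > 0" using assms by (simp add: L_def)
  obtain j where k: "k = Suc j" using assms(3) by (cases k) auto
  have "2 ^ k * (k * (k - 1)) = 2 * 2 ^ j * (Suc j * j)" by (simp add: k)
  also have "\<dots> \<le> 2 * 2 ^ j * (4 * 2 ^ j)" by (intro mult_left_mono Suc_mult_self_le_power2) auto
  also have "\<dots> = 8 * (2 * 2) ^ j" by (simp only: power_mult_distrib)
  also have "\<dots> \<le> 8 * n" using assms(5) by (simp add: k)
  finally have r: "2 * n + 2 * (2 ^ k * (k * (k - 1))) \<le> 18 * n" by linarith
  have "real (m + n) \<le> 2 * 4 ^ k"
  proof -
    have "m + n \<le> 2 * 4 ^ k" using assms by simp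
    then have "real (m + n) \<le> real (2 * 4 ^ k)" by (rule of_nat_mono)
    then show ?thesis by simp
  qed
  then have "L \<le> ln (2 * 4 ^ k)" unfolding L_def using assms by (subst ln_le_cancel_iff) auto
  also have "\<dots> = ln 2 + real k * ln (2 ^ 2)" by (simp add: ln_mult ln_realpow)
  also have "\<dots> = (2 * real k + 1) * ln 2" by (subst ln_realpow) (auto simp: algebra_simps)
  also have "\<dots> \<le> (2 * real k + 1) * 1" using ln_2_less_1 by (intro mult_left_mono) auto
  also have "\<dots> \<le> 3 * real k" using assms(3) by simp
  finally have Lk: "L \<le> 3 * real k" .
  have "real ((m + k - 1) div k) \<le> real (m + k - 1) / real k" by (rule of_nat_div_le_of_nat)
  also have "\<dots> \<le> (real m + real k) / real k" using assms(3) by (intro divide_right_mono) auto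
  also have "\<dots> = real m * (1 / real k) + 1" using assms(3) by (simp add: field_simps)
  \<comment> \<open>The only use of \<open>lnK\<close>: it replaces the summand 1 by a multiple of
    \<open>m / L\<close>.\<close>
  also have "\<dots> \<le> real m * (3 / L) + \<bar>K\<bar> * real m / L"
  proof (intro add_mono mult_left_mono)
    show "1 / real k \<le> 3 / L" using Lk L assms(3) by (simp add: field_simps)
    have "L \<le> K * real m" using lnK by (simp add: L_def)
    also have "\<dots> \<le> \<bar>K\<bar> * real m" by (intro mult_right_mono) auto
    finally show "1 \<le> \<bar>K\<bar> * real m / L" using L by simp
  qed simp
  also have "\<dots> = (3 + \<bar>K\<bar>) * real m / L" by (simp add: algebra_simps add_divide_distrib)
  finally have c: "real ((m + k - 1) div k) \<le> (3 + \<bar>K\<bar>) * real m / L" .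
  have "real ((m + k - 1) div k * (2 * n + 2 * (2 ^ k * (k * (k - 1)))))
      \<le> ((3 + \<bar>K\<bar>) * real m / L) * real (18 * n)"
    unfolding of_nat_mult[of "(m + k - 1) div k"] using c r by (intro mult_mono of_nat_mono) auto
  also have "\<dots> = 18 * (3 + \<bar>K\<bar>) * (real (m * n) / L)" by simp
  finally show ?thesis by (simp add: L_def)
qed

section \<open>The theorem\<close>

text \<open>Degree 4: at most \<open>N\<close> blocks, \<open>N\<close> pivots in each, and
  quadratic time per pivot, with \<open>N\<close> the total number of vertices. The term
  \<open>72 * X\<close> collects the two offset tables and the search for the block size.\<close>

definition running_time :: "nat poly" where
  "running_time =
     (let X = [:0, 1:] in 2 * (X * (X * (X * (75 * X + 137) + 113) + 39) + 9) + 72 * X + 63)"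

text \<open>The weight is bounded in terms of \<open>k\<close>, without logarithms and without
  \<open>K\<close>, since the program knows neither.\<close>

lemma find_decomposition_runs:
  fixes xs ys :: "'v list"
  assumes "distinct xs" "distinct ys" "E \<subseteq> set xs \<times> set ys"
  defines "a \<equiv> length xs" and "b \<equiv> length ys"
  shows "runs find_decomposition (input_memory xs ys E) (poly running_time (a + b))
    (\<lambda>s. \<exists>D k. outputs s xs ys D \<and> decomposition (set xs) (set ys) E D \<and> balanced D \<and>
       k \<ge> 1 \<and> max a b < 4 ^ k \<and> 4 ^ (k - 1) \<le> max 1 (max a b) \<and>
       complexity D \<le> (min a b + k - 1) div k * (2 * max a b + 2 * (2 ^ k * (k * (k - 1)))))"
proof -
  define sw where "sw \<longleftrightarrow> b < a"
  define m n N where "m = min a b" and "n = max a b" and "N = a + b"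
  define rs cs where "rs = (if sw then 1 else b)" and "cs = (if sw then b else 1)"
  note defs = sw_def m_def n_def rs_def cs_def
  have mb: "sw \<Longrightarrow> m = b \<and> n = a" "\<not> sw \<Longrightarrow> m = a \<and> n = b"
    by (simp_all add: sw_def m_def n_def)
  \<comment> \<open>The edge set in layout coordinates; after an exchange the row index refers to
    \<open>ys\<close>.\<close>
  define M where "M = {(i, j). i < m \<and> j < n \<and> (if sw then (xs ! j, ys ! i) else (xs ! i, ys ! j)) \<in> E}"
  \<comment> \<open>Division with remainder decodes an address; this yields both the injectivity of
    the layout and the entries of the input matrix.\<close>
  have split: "(u * b + v) div b = u \<and> (u * b + v) mod b = v \<and> u * b + v < a * b" if "u < a" "v < b" for u v
  proof -
    have "u * b + v < Suc u * b" using that by simp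
    also have "\<dots> \<le> a * b" using that by (intro mult_right_mono) auto
    finally show ?thesis using that by simp
  qed
  have inj: "inj_on (\<lambda>(i, j). i * rs + j * cs) ({..<m} \<times> {..<n})"
  proof (rule inj_onI, clarify)
    fix i j i' j' assume *: "i * rs + j * cs = i' * rs + j' * cs" "i < m" "j < n" "i' < m" "j' < n"
    show "i = i' \<and> j = j'"
    proof (cases sw)
      case True
      then have "j * b + i = j' * b + i'" using *(1) by (simp add: rs_def cs_def)
      then show ?thesis using split[of j i] split[of j' i'] *(2-5) mb(1)[OF True] by metis
    next
      case False
      then have "i * b + j = i' * b + j'" using *(1) by (simp add: rs_def cs_def)
      then show ?thesis using split[of i j] split[of i' j'] *(2-5) mb(2)[OF False] by metis
    qed
  qed
  interpret layout m n rs cs sw N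
    by unfold_locales (use inj in \<open>auto simp: m_def n_def N_def\<close>)
  let ?input = "input_memory xs ys E"
  have stM: "stores M s" if "s matrix = ?input matrix" for s
    unfolding stores_def
  proof (intro conjI allI impI)
    show "M \<subseteq> {..<m} \<times> {..<n}" by (auto simp: M_def)
    fix i j assume ij: "i < m" "j < n"
    show "s matrix (i * rs + j * cs) = of_bool ((i, j) \<in> M)"
    proof (cases sw)
      case True
      then show ?thesis using that ij mb split[of j i]
        by (simp add: input_memory_def M_def rs_def cs_def a_def b_def add.commute)
    next
      case False
      then show ?thesis using that ij mb split[of i j]
        by (simp add: input_memory_def M_def rs_def cs_def a_def b_def)
    qed
  qed
  have out: "\<exists>D. outputs s xs ys D \<and> decomposition (set xs) (set ys) E D \<and> balanced D \<and> complexity D = weight I"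
    if wr: "written I s" and bp: "biclique_partition M I" for s I
  proof -
    \<comment> \<open>Undoes the exchange of the classes, matching the order in which the lists were
      written.\<close>
    define I' where "I' = (if sw then map prod.swap I else I)"
    define F where "F = (if sw then prod.swap ` M else M)"
    have bp': "biclique_partition F I'" using bp biclique_partition_swap[OF bp] by (simp add: I'_def F_def)
    have Fs: "F \<subseteq> {..<length xs} \<times> {..<length ys}"
      using mb by (auto simp: F_def M_def a_def b_def)
    have F_iff: "(i, j) \<in> F \<longleftrightarrow> i < a \<and> j < b \<and> (xs ! i, ys ! j) \<in> E" for i j
      using mb by (auto simp: F_def M_def image_iff)
    have "map_prod ((!) xs) ((!) ys) ` F = E"
    proof (intro equalityI subsetI)
      fix e assume e: "e \<in> E"
      then obtain u v where uv: "e = (u, v)" "u \<in> set xs" "v \<in> set ys" using assms(3) by auto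
      then obtain i j where "i < a" "xs ! i = u" "j < b" "ys ! j = v"
        unfolding a_def b_def by (metis in_set_conv_nth)
      then show "e \<in> map_prod ((!) xs) ((!) ys) ` F"
        using e uv by (intro image_eqI[of _ _ "(i, j)"]) (auto simp: F_iff)
    qed (auto simp: F_iff)
    note D = decomposition_of_biclique_partition[OF bp' Fs assms(1,2), unfolded this]
    have wI: "weight I' = weight I" by (simp add: I'_def weight_swap)
    \<comment> \<open>\<open>written\<close> describes cell 0 and the cells from 1 on separately;
      together they form the output code.\<close>
    have "output_code I' = map (s outp) [0..<s out_end 0]"
      using wr by (simp add: written_def output_code_def I'_def upt_conv_Cons)
    then have "\<forall>n < length (output_code I'). s 2 n = output_code I' ! n" by simp
    then have "outputs s xs ys (map (\<lambda>(us, vs). ((!) xs ` set us, (!) ys ` set vs)) I')"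
      unfolding outputs_def using D(4) by blast
    then show ?thesis using D(1-3) wI by auto
  qed
  have time: "poly running_time (a + b) = 2 * blocks_time + 72 * N + 63"
    unfolding blocks_time_def pivot_time_def N_def[symmetric] by (simp add: running_time_def Let_def algebra_simps)
  define Q where "Q = (\<lambda>s. \<exists>D k. outputs s xs ys D \<and> decomposition (set xs) (set ys) E D \<and> balanced D \<and>
       k \<ge> 1 \<and> n < 4 ^ k \<and> 4 ^ (k - 1) \<le> max 1 n \<and>
       complexity D \<le> (m + k - 1) div k * (2 * n + 2 * (2 ^ k * (k * (k - 1)))))"
  have init: "?input sizes 0 = a" "?input sizes 1 = b" by (simp_all add: input_memory_def a_def b_def)
  have zero: "?input k = (\<lambda>_. 0)" if "k > 1" for k using that by (simp add: input_memory_def)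
  have "runs find_decomposition ?input (2 * blocks_time + 72 * N + 63) Q"
    unfolding find_decomposition_def
  proof (rule runs_Seq[OF choose_layout_runs[of ?input a b, OF init], where T' = "2 * blocks_time + 72 * N + 39"], goal_cases)
    case (1 s1)
    then have F1: "frame {height, width, swapped, row_step, col_step} ?input s1"
      and v1: "s1 height 0 = m" "s1 width 0 = n" "s1 swapped 0 = of_bool sw" "s1 row_step 0 = rs" "s1 col_step 0 = cs"
      by (simp_all add: defs)
    have z1: "s1 row_offset 0 = 0" "s1 col_offset 0 = 0" "s1 outp = (\<lambda>_. 0)" "s1 matrix = ?input matrix"
      using F1 zero by (simp_all add: frame_def)
    have R: "runs (fill_offsets row_offset row_step height) s1 (23 * N + 10)
      (\<lambda>s'. frame {row_offset, row} s1 s' \<and> (\<forall>i\<le>m. s' row_offset i = i * rs))"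
      using z1 v1 m_le by (intro fill_offsets_runs) auto
    show ?case
    proof (rule runs_Seq[OF R, where T' = "2 * blocks_time + 49 * N + 29"], goal_cases)
      case s2: (1 s2)
      then have v2: "s2 col_offset 0 = 0" "s2 col_step 0 = cs" "s2 width 0 = n"
        using z1 v1 by (simp_all add: frame_def)
      have C: "runs (fill_offsets col_offset col_step width) s2 (23 * N + 10)
        (\<lambda>s'. frame {col_offset, row} s2 s' \<and> (\<forall>j\<le>n. s' col_offset j = j * cs))"
        using v2 n_le by (intro fill_offsets_runs) auto
      show ?case
      proof (rule runs_Seq[OF C, where T' = "2 * blocks_time + 26 * N + 19"],
          rule runs_Seq_Put[where T = "2 * blocks_time + 26 * N + 16"], simp, goal_cases)
        case (1 s3)
        let ?s = "s3(out_end := (s3 out_end)(aval (Num 0) s3 := aval (Num 1) s3))"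
        have v3: "env ?s" "?s outp = (\<lambda>_. 0)" "?s matrix = ?input matrix" "?s width 0 = n" "?s out_end 0 = 1"
          using 1 s2 v1 z1 by (simp_all add: frame_def env_def)
        have wr: "written [] ?s" using v3 by (simp add: written_def)
        show ?case
        proof (rule runs_Seq[OF choose_block_size_runs[of ?s n N, OF v3(4) n_le], where T' = "2 * blocks_time + 3"], goal_cases)
          case (1 s4)
          then obtain k where F4: "frame {block_size, power4} ?s s4"
            and k: "k \<ge> 1" "s4 block_size 0 = k" "n < 4 ^ k" "4 ^ (k - 1) \<le> max 1 n" by blast
          have "env s4" "stores M s4" "written [] s4"
            using env_frame[OF F4] stores_frame[OF F4] written_frame[OF F4] v3(1) stM[of ?s, OF v3(3)] wr by simp_all
          from two_rounds_runs[OF this k(2,1)] show ?case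
            by (rule runs_mono[OF _ order_refl]) (use out k in \<open>force simp: Q_def\<close>)
        qed simp
      qed simp
    qed simp
  qed simp
  then show ?thesis by (simp add: time Q_def m_def n_def)
qed

text \<open>The program and its time bound are fixed before \<open>K\<close>; only \<open>c\<close>
  depends on it. Some condition on the sizes is unavoidable by
  \<open>no_bound_for_all_bipartite_graphs\<close>, and \<open>balanced_bound_imp_ln_le\<close>
  shows that complete bipartite graphs force one of this very form.\<close>

theorem theorem3:
  shows "\<exists>(P :: prog) (p :: nat poly). \<forall>K :: real. \<exists>c > 0.
    \<forall>(A :: 'v set) (B :: 'v set) E xs ys.
      bipartite_graph A B E \<and> card A + card B \<ge> 2 \<and>
      distinct xs \<and> set xs = A \<and> distinct ys \<and> set ys = B \<longrightarrow>
      (\<exists>t s D.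
         exec P (input_memory xs ys E) t s \<and>
         t \<le> poly p (card A + card B) \<and>
         outputs s xs ys D \<and>
         decomposition A B E D \<and>
         balanced D \<and>
         (ln (real (card A + card B)) \<le> K * real (min (card A) (card B)) \<longrightarrow>
           real (complexity D) \<le> c * (real (card A * card B) / ln (real (card A + card B)))))"
proof (intro exI[of _ find_decomposition] exI[of _ running_time] allI)
  fix K :: real
  let ?c = "18 * (3 + \<bar>K\<bar>)"
  show "\<exists>c > 0. \<forall>(A :: 'v set) (B :: 'v set) E xs ys.
      bipartite_graph A B E \<and> card A + card B \<ge> 2 \<and>
      distinct xs \<and> set xs = A \<and> distinct ys \<and> set ys = B \<longrightarrow>
      (\<exists>t s D.
         exec find_decomposition (input_memory xs ys E) t s \<and>
         t \<le> poly running_time (card A + card B) \<and>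
         outputs s xs ys D \<and>
         decomposition A B E D \<and>
         balanced D \<and>
         (ln (real (card A + card B)) \<le> K * real (min (card A) (card B)) \<longrightarrow>
           real (complexity D) \<le> c * (real (card A * card B) / ln (real (card A + card B)))))"
  proof (intro exI[of _ ?c] conjI allI impI, simp)
    fix A B :: "'v set" and E xs ys
    assume "bipartite_graph A B E \<and> card A + card B \<ge> 2 \<and>
      distinct xs \<and> set xs = A \<and> distinct ys \<and> set ys = B"
    then have G: "bipartite_graph A B E" and two: "card A + card B \<ge> 2"
      and xs: "distinct xs" "set xs = A" and ys: "distinct ys" "set ys = B" by auto
    have len: "length xs = card A" "length ys = card B"
      using xs ys distinct_card by force+
    have "E \<subseteq> set xs \<times> set ys" using G xs ys by (simp add: bipartite_graph_def)
    from find_decomposition_runs[OF xs(1) ys(1) this]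
    obtain t s D k where ex: "exec find_decomposition (input_memory xs ys E) t s"
      "t \<le> poly running_time (card A + card B)" "outputs s xs ys D" "decomposition A B E D" "balanced D"
      and k: "k \<ge> 1" "max (card A) (card B) < 4 ^ k" "4 ^ (k - 1) \<le> max 1 (max (card A) (card B))"
      and D: "complexity D \<le> (min (card A) (card B) + k - 1) div k *
        (2 * max (card A) (card B) + 2 * (2 ^ k * (k * (k - 1))))"
      unfolding runs_def len xs(2) ys(2) by blast
    have "real (complexity D) \<le> ?c * (real (card A * card B) / ln (real (card A + card B)))"
      if K: "ln (real (card A + card B)) \<le> K * real (min (card A) (card B))"
    proof -
      let ?m = "min (card A) (card B)" and ?n = "max (card A) (card B)"
      have mn: "?m + ?n = card A + card B" "?m * ?n = card A * card B" by (auto simp: min_def max_def)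
      have "ln (real (card A + card B)) > 0" using two by simp
      \<comment> \<open>An empty class would make the right side of the condition 0, against a
        positive logarithm.\<close>
      then have m: "1 \<le> ?m" using K by (cases "?m = 0") auto
      have "real (complexity D) \<le> real ((?m + k - 1) div k * (2 * ?n + 2 * (2 ^ k * (k * (k - 1)))))"
        using D by (rule of_nat_mono)
      also have "\<dots> \<le> ?c * (real (?m * ?n) / ln (real (?m + ?n)))"
        by (rule total_weight_bound) (use m k K mn in auto)
      finally show ?thesis unfolding mn .
    qed
    with ex show "\<exists>t s D.
         exec find_decomposition (input_memory xs ys E) t s \<and>
         t \<le> poly running_time (card A + card B) \<and>
         outputs s xs ys D \<and>
         decomposition A B E D \<and>
         balanced D \<and>
         (ln (real (card A + card B)) \<le> K * real (min (card A) (card B)) \<longrightarrow>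
           real (complexity D) \<le> ?c * (real (card A * card B) / ln (real (card A + card B))))"
      by blast
  qed
qed

end
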